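(* For any (fixed) integer $\ell\geq 0$, finding a maximum independent set can be done in polynomial time for graphs in the class of $(2,\ell)$-graphs.
   Context: Graphs are finite, simple and undirected. For integers $k,\ell\ge 0$, a $(k,\ell)$-graph is a graph whose vertex set can be partitioned into $k$ independent sets and $\ell$ cliques, where parts are allowed to be empty (and a single vertex may be counted either as an independent set or as a clique); such a partition is a $(k,\ell)$-partition. A maximum independent set is an independent set of largest cardinality. The input is the graph alone; no $(2,\ell)$-partition is given. *)

theory Defs
  imports "HOL-Library.Disjoint_Sets" "HOL-Computational_Algebra.Polynomial"
begin

section \<open>Graphs\<close>

definition simple_graph :: "'a set \<Rightarrow> 'a set set \<Rightarrow> bool" where
  "simple_graph V E \<longleftrightarrow> finite V \<and> (\<forall>e\<in>E. e \<subseteq> V \<and> card e = 2)"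

definition independent_set :: "'a set \<Rightarrow> 'a set set \<Rightarrow> 'a set \<Rightarrow> bool" where
  "independent_set V E S \<longleftrightarrow> S \<subseteq> V \<and> (\<forall>u\<in>S. \<forall>v\<in>S. {u, v} \<notin> E)"

definition clique :: "'a set \<Rightarrow> 'a set set \<Rightarrow> 'a set \<Rightarrow> bool" where
  "clique V E S \<longleftrightarrow> S \<subseteq> V \<and> (\<forall>u\<in>S. \<forall>v\<in>S. u \<noteq> v \<longrightarrow> {u, v} \<in> E)"

definition max_independent_set :: "'a set \<Rightarrow> 'a set set \<Rightarrow> 'a set \<Rightarrow> bool" where
  "max_independent_set V E S \<longleftrightarrow>
     independent_set V E S \<and> (\<forall>T. independent_set V E T \<longrightarrow> card T \<le> card S)"

definition kl_partition ::
  "nat \<Rightarrow> nat \<Rightarrow> 'a set \<Rightarrow> 'a set set \<Rightarrow> (nat \<Rightarrow> 'a set) \<Rightarrow> (nat \<Rightarrow> 'a set) \<Rightarrow> bool" where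
  "kl_partition k l V E A B \<longleftrightarrow>
     (\<forall>i<k. independent_set V E (A i)) \<and>
     (\<forall>j<l. clique V E (B j)) \<and>
     disjoint_family_on A {..<k} \<and>
     disjoint_family_on B {..<l} \<and>
     (\<Union>i<k. A i) \<inter> (\<Union>j<l. B j) = {} \<and>
     (\<Union>i<k. A i) \<union> (\<Union>j<l. B j) = V"

definition kl_graph :: "nat \<Rightarrow> nat \<Rightarrow> 'a set \<Rightarrow> 'a set set \<Rightarrow> bool" where
  "kl_graph k l V E \<longleftrightarrow> simple_graph V E \<and> (\<exists>A B. kl_partition k l V E A B)"


section \<open>Random access machine programs\<close>

text \<open>
  Structured programs for a random access machine whose memory is divided into arrays, each
  unbounded and indexed and filled by natural numbers. A program names only finitely many arrays,
  and array names cannot be computed; scalar variables are arrays used at index 0 only.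

  The cost measure is uniform. Multiplication is deliberately not primitive: with addition and
  truncated subtraction only, one step of a given program increases the bit length of the largest
  number in memory by at most a constant, so after \<open>t\<close> steps all numbers have a bit length linear
  in \<open>t\<close> plus that of the input, and polynomial time here coincides with polynomial time on
  Turing machines. For the same reason it is harmless that a whole expression is evaluated in one
  step: its size is a constant of the program.
\<close>

type_synonym memory = "nat \<Rightarrow> nat \<Rightarrow> nat"

datatype aexp = Const nat | At nat aexp | Plus aexp aexp | Minus aexp aexp

datatype bexp = Less aexp aexp | Neg bexp | Conj bexp bexp

datatype com =
    Skip
  | Store nat aexp aexp
  | Seq com com
  | Cond bexp com com
  | While bexp com

fun aval :: "aexp \<Rightarrow> memory \<Rightarrow> nat" where
  "aval (Const c) s = c"
| "aval (At a e) s = s a (aval e s)"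
| "aval (Plus e f) s = aval e s + aval f s"
| "aval (Minus e f) s = aval e s - aval f s"

fun bval :: "bexp \<Rightarrow> memory \<Rightarrow> bool" where
  "bval (Less e f) s \<longleftrightarrow> aval e s < aval f s"
| "bval (Neg b) s \<longleftrightarrow> \<not> bval b s"
| "bval (Conj b c) s \<longleftrightarrow> bval b s \<and> bval c s"

text \<open>
  \<open>exec c s t s'\<close>: started in memory \<open>s\<close>, the program \<open>c\<close> halts after exactly \<open>t\<close> steps in
  memory \<open>s'\<close>.
\<close>

inductive exec :: "com \<Rightarrow> memory \<Rightarrow> nat \<Rightarrow> memory \<Rightarrow> bool" where
  Skip: "exec Skip s 1 s"
| Store: "exec (Store a e f) s 1 (s(a := (s a)(aval e s := aval f s)))"
| Seq: "exec c s t s' \<Longrightarrow> exec d s' u s'' \<Longrightarrow> exec (Seq c d) s (t + u) s''"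
| CondTrue: "bval b s \<Longrightarrow> exec c s t s' \<Longrightarrow> exec (Cond b c d) s (1 + t) s'"
| CondFalse: "\<not> bval b s \<Longrightarrow> exec d s t s' \<Longrightarrow> exec (Cond b c d) s (1 + t) s'"
| WhileFalse: "\<not> bval b s \<Longrightarrow> exec (While b c) s 1 s"
| WhileTrue: "bval b s \<Longrightarrow> exec c s t s' \<Longrightarrow> exec (While b c) s' u s'' \<Longrightarrow>
    exec (While b c) s (1 + t + u) s''"

inductive_cases SkipE: "exec Skip s t s'"
inductive_cases StoreE: "exec (Store a e f) s t s'"
inductive_cases SeqE: "exec (Seq c d) s t s'"
inductive_cases CondE: "exec (Cond b c d) s t s'"
inductive_cases WhileE: "exec (While b c) s t s'"

lemma exec_deterministic:
  "exec c s t s' \<Longrightarrow> exec c s u s'' \<Longrightarrow> t = u \<and> s' = s''"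
proof (induction arbitrary: u s'' rule: exec.induct)
  case (Skip s)
  then show ?case by (rule SkipE) simp
next
  case (Store a e f s)
  then show ?case by (rule StoreE) simp
next
  case (Seq c s t s' d u s'')
  from Seq.prems show ?case by (rule SeqE) (auto dest!: Seq.IH)
next
  case (CondTrue b s c t s' d)
  from CondTrue.prems show ?case by (rule CondE) (auto simp: CondTrue.hyps(1) dest!: CondTrue.IH)
next
  case (CondFalse b s d t s' c)
  from CondFalse.prems show ?case by (rule CondE) (auto simp: CondFalse.hyps(1) dest!: CondFalse.IH)
next
  case (WhileFalse b s c)
  from WhileFalse.prems show ?case by (rule WhileE) (simp_all add: WhileFalse.hyps)
next
  case (WhileTrue b s c t s' u s'')
  from WhileTrue.prems show ?case by (rule WhileE) (auto simp: WhileTrue.hyps(1) dest!: WhileTrue.IH)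
qed


section \<open>Polynomial-time search problems on graphs\<close>

text \<open>
  The input is a graph with vertex set \<open>{..<n}\<close>. Array 0 holds \<open>n\<close> at index 0, array 1 holds the
  adjacency matrix row by row (the entry for \<open>i, j < n\<close> is at index \<open>i * n + j\<close>), and all other
  memory is 0. The output is the set of vertices marked by a nonzero entry of array 2.
\<close>

definition input_memory :: "nat \<Rightarrow> nat set set \<Rightarrow> memory" where
  "input_memory n E = (\<lambda>a k.
     if a = 0 \<and> k = 0 then n
     else if a = 1 \<and> k < n * n \<and> {k div n, k mod n} \<in> E then 1
     else 0)"

definition output_set :: "nat \<Rightarrow> memory \<Rightarrow> nat set" where
  "output_set n s = {v. v < n \<and> s 2 v \<noteq> 0}"

text \<open>
  A single program must, on every graph of the class \<open>P\<close>, halt with an output \<open>S\<close> satisfying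
  \<open>R V E S\<close>; nothing is required on graphs outside the class. The input has size between \<open>n\<close> and a
  polynomial in \<open>n\<close>, so that running times may be bounded in terms of the number \<open>n\<close> of vertices.
\<close>

definition poly_time_search ::
  "(nat set \<Rightarrow> nat set set \<Rightarrow> bool) \<Rightarrow> (nat set \<Rightarrow> nat set set \<Rightarrow> nat set \<Rightarrow> bool) \<Rightarrow> bool" where
  "poly_time_search P R \<longleftrightarrow>
     (\<exists>(c :: com) (p :: nat poly). \<forall>(n :: nat) E.
        simple_graph {..<n} E \<longrightarrow> P {..<n} E \<longrightarrow>
        (\<exists>t s. exec c (input_memory n E) t s \<and> t \<le> poly p n \<and> R {..<n} E (output_set n s)))"

end

theory Submission
  imports Defs
begin

text \<open>
  No partition is computed. Call the independent sets of some \<open>(2, l)\<close>-partition its sparse part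
  \<open>Z\<close> and the cliques its dense part \<open>D\<close>. A bipartite vertex set meets \<open>D\<close> in at most \<open>2 * l\<close>
  vertices. Hence a bipartite vertex set \<open>A\<close> that cannot be enlarged by exchanging at most
  \<open>4 * l + 1\<close> vertices contains all but \<open>2 * l\<close> vertices of \<open>Z\<close>: otherwise drop \<open>A \<inter> D\<close> and add one
  more vertex of \<open>Z - A\<close> than was dropped. Such an \<open>A\<close> is found by local search in at most \<open>n\<close>
  rounds. An independent set has at most \<open>l\<close> vertices in \<open>D\<close>, hence at most \<open>3 * l\<close> outside \<open>A\<close>;
  once these are guessed, a maximum independent set of a bipartite graph remains to be found.

  For the latter, one side of the bipartite graph bids for the vertices of the other: an unmatched
  bidder takes its cheapest neighbour, evicting the previous holder, and raises the price by 1,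
  until every unmatched bidder sees only prices of at least \<open>n\<close>. Some price between 1 and \<open>n\<close> does
  not occur, and cutting there yields an independent set into which every other vertex is matched.
  Since every candidate is checked, the program need not know where to cut: it tries all thresholds.
\<close>

section \<open>Programs with bounded loops\<close>

text \<open>
  Every loop runs its counter (index 0 of an array of its own) through all vertices, so that
  halting within polynomial time can be read off the syntax.
\<close>

datatype prog =
    PStore nat aexp aexp
  | PSeq prog prog
  | PIf bexp prog
  | PFor nat prog

abbreviation Var :: "nat \<Rightarrow> aexp" where
  "Var a \<equiv> At a (Const 0)"

definition put :: "nat \<Rightarrow> nat \<Rightarrow> memory \<Rightarrow> memory" where
  "put a x s = s(a := (s a)(0 := x))"

lemma put_other [simp]: "b \<noteq> a \<Longrightarrow> put a x s b = s b"
  by (simp add: put_def)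

lemma put_apply [simp]: "put a x s b k = (if b = a \<and> k = 0 then x else s b k)"
  by (simp add: put_def)

lemma fun_upd_eq_put [simp]: "s(a := (s a)(0 := x)) = put a x s"
  by (simp add: put_def)

fun compile :: "prog \<Rightarrow> com" where
  "compile (PStore a e f) = Store a e f"
| "compile (PSeq p q) = Seq (compile p) (compile q)"
| "compile (PIf b p) = Cond b (compile p) Skip"
| "compile (PFor i p) =
     Seq (Store i (Const 0) (Const 0))
       (While (Less (Var i) (Var 0)) (Seq (compile p) (Store i (Const 0) (Plus (Var i) (Const 1)))))"

text \<open>The loop bound \<open>n\<close> is a parameter and not read from memory, which makes the
  semantics a total function. The last \<open>put i n\<close> supplies the value with which the
  counter leaves the compiled while loop.\<close>

fun sem :: "nat \<Rightarrow> prog \<Rightarrow> memory \<Rightarrow> memory" where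
  "sem n (PStore a e f) s = s(a := (s a)(aval e s := aval f s))"
| "sem n (PSeq p q) s = sem n q (sem n p s)"
| "sem n (PIf b p) s = (if bval b s then sem n p s else s)"
| "sem n (PFor i p) s = put i n (fold (\<lambda>j s. sem n p (put i j s)) [0..<n] s)"

fun written :: "prog \<Rightarrow> nat set" where
  "written (PStore a e f) = {a}"
| "written (PSeq p q) = written p \<union> written q"
| "written (PIf b p) = written p"
| "written (PFor i p) = insert i (written p)"

text \<open>Keeping array 0 constant keeps the loop bound constant, and a body that spares its
  counter can neither prolong nor cut the loop; so the compiled loop makes exactly \<open>n\<close>
  iterations.\<close>

fun wf_prog :: "prog \<Rightarrow> bool" where
  "wf_prog (PStore a e f) \<longleftrightarrow> a \<noteq> 0"
| "wf_prog (PSeq p q) \<longleftrightarrow> wf_prog p \<and> wf_prog q"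
| "wf_prog (PIf b p) \<longleftrightarrow> wf_prog p"
| "wf_prog (PFor i p) \<longleftrightarrow> i \<noteq> 0 \<and> i \<notin> written p \<and> wf_prog p"

text \<open>\<open>[:0, 1:]\<close> is the polynomial X. A loop pays one step for initialising the
  counter and one for the final failing test; besides the body, an iteration pays one for the test
  and one for the increment.\<close>

fun time_poly :: "prog \<Rightarrow> nat poly" where
  "time_poly (PStore a e f) = 1"
| "time_poly (PSeq p q) = time_poly p + time_poly q"
| "time_poly (PIf b p) = 2 + time_poly p"
| "time_poly (PFor i p) = 2 + [:0, 1:] * (2 + time_poly p)"

lemma sem_frame: "a \<notin> written p \<Longrightarrow> sem n p s a = s a"
proof (induction p arbitrary: s)
  case (PFor i p)
  have "fold (\<lambda>j s. sem n p (put i j s)) xs s a = s a" for xs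
    using PFor by (induction xs arbitrary: s) auto
  then show ?case using PFor.prems by simp
qed auto

lemma wf_not_written: "wf_prog p \<Longrightarrow> 0 \<notin> written p"
  by (induction p) auto

lemma exec_compile:
  assumes "wf_prog p" "s 0 0 = n"
  shows "\<exists>t. exec (compile p) s t (sem n p s) \<and> t \<le> poly (time_poly p) n"
  using assms
proof (induction p arbitrary: s)
  case (PStore a e f)
  show ?case unfolding compile.simps sem.simps
    by (rule exI[of _ 1], rule conjI, rule exec.Store) simp
next
  case (PSeq p q)
  obtain t where t: "exec (compile p) s t (sem n p s)" "t \<le> poly (time_poly p) n"
    using PSeq by auto
  have "sem n p s 0 0 = n"
    using PSeq.prems wf_not_written sem_frame by auto
  then obtain u where "exec (compile q) (sem n p s) u (sem n q (sem n p s))"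
      "u \<le> poly (time_poly q) n"
    using PSeq.IH(2)[of "sem n p s"] PSeq.prems by auto
  then show ?case using t exec.Seq[OF t(1)]
    by (intro exI[of _ "t + u"]) auto
next
  case (PIf b p)
  show ?case
  proof (cases "bval b s")
    case True
    obtain t where "exec (compile p) s t (sem n p s)" "t \<le> poly (time_poly p) n"
      using PIf.IH[of s] PIf.prems by auto
    then show ?thesis using True exec.CondTrue[OF True, of "compile p" t]
      by (intro exI[of _ "1 + t"]) auto
  next
    case False
    then have "exec (compile (PIf b p)) s (1 + 1) (sem n (PIf b p) s)"
      using exec.CondFalse[OF False exec.Skip] by simp
    then show ?thesis by (intro exI[of _ "1 + 1"]) simp
  qed
next
  case (PFor i p)
  define W where
    "W = While (Less (Var i) (Var 0)) (Seq (compile p) (Store i (Const 0) (Plus (Var i) (Const 1))))"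
  define T where "T = poly (time_poly p) n"
  have i: "i \<noteq> 0" "i \<notin> written p" "wf_prog p" using PFor.prems by auto
  \<comment> \<open>Induction on the number \<open>k\<close> of iterations that remain; the counter
    then stands at \<open>n - k\<close>.\<close>
  have loop: "\<exists>t. exec W (put i (n - k) s) t
      (put i n (fold (\<lambda>j s. sem n p (put i j s)) [n - k..<n] s)) \<and> t \<le> 1 + k * (2 + T)"
    if "k \<le> n" "s 0 0 = n" for k s
    using that
  proof (induction k arbitrary: s)
    case 0
    then have "\<not> bval (Less (Var i) (Var 0)) (put i n s)" using i by simp
    then have "exec W (put i n s) 1 (put i n s)"
      unfolding W_def by (rule exec.WhileFalse)
    then show ?case by (intro exI[of _ 1]) (simp del: put_apply)
  next
    case (Suc k)
    let ?j = "n - Suc k"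
    let ?s = "put i ?j s"
    let ?s' = "sem n p ?s"
    have "?s 0 0 = n" using i Suc.prems by simp
    then obtain t where t: "exec (compile p) ?s t ?s'" "t \<le> T"
      using PFor.IH[OF i(3)] unfolding T_def by blast
    have s'0: "?s' 0 0 = n" and s'i: "?s' i 0 = ?j"
      using i Suc.prems wf_not_written[of p] sem_frame[of _ p n ?s] by auto
    have "exec (Store i (Const 0) (Plus (Var i) (Const 1))) ?s' 1 (put i (n - k) ?s')"
      using exec.Store[of i "Const 0" "Plus (Var i) (Const 1)" ?s'] s'i Suc.prems
      by (simp add: Suc_diff_Suc)
    then have body: "exec (Seq (compile p) (Store i (Const 0) (Plus (Var i) (Const 1))))
        ?s (t + 1) (put i (n - k) ?s')"
      using t by (blast intro: exec.Seq)
    obtain u where u: "exec W (put i (n - k) ?s') u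
        (put i n (fold (\<lambda>j s. sem n p (put i j s)) [n - k..<n] ?s'))" "u \<le> 1 + k * (2 + T)"
      using Suc.IH[of ?s'] s'0 Suc.prems by (auto simp del: put_apply)
    have "[?j..<n] = ?j # [n - k..<n]"
      using Suc.prems by (simp add: upt_rec[of ?j] Suc_diff_Suc)
    then have "put i n (fold (\<lambda>j s. sem n p (put i j s)) [?j..<n] s) =
        put i n (fold (\<lambda>j s. sem n p (put i j s)) [n - k..<n] ?s')"
      by simp
    moreover have "exec W ?s (1 + (t + 1) + u)
        (put i n (fold (\<lambda>j s. sem n p (put i j s)) [n - k..<n] ?s'))"
      unfolding W_def
    proof (rule exec.WhileTrue)
      show "bval (Less (Var i) (Var 0)) ?s" using i Suc.prems by simp
    qed (use body u(1) in \<open>simp_all only: W_def\<close>)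
    ultimately show ?case using t u by (intro exI[of _ "1 + (t + 1) + u"]) (auto simp del: put_apply)
  qed
  obtain t where t: "exec W (put i 0 s) t (sem n (PFor i p) s)" "t \<le> 1 + n * (2 + T)"
    using loop[of n s] PFor.prems by auto
  have "exec (compile (PFor i p)) s (1 + t) (sem n (PFor i p) s)"
    unfolding compile.simps W_def[symmetric]
    by (rule exec.Seq[OF _ t(1)]) (use exec.Store[of i "Const 0" "Const 0" s] in simp)
  then show ?case using t(2) unfolding T_def
    by (intro exI[of _ "1 + t"]) (simp add: algebra_simps del: put_apply)
qed

lemma poly_time_searchI:
  assumes "wf_prog p"
    and "\<And>n E. simple_graph {..<n} E \<Longrightarrow> P {..<n} E \<Longrightarrow>
      R {..<n} E (output_set n (sem n p (input_memory n E)))"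
  shows "poly_time_search P R"
  unfolding poly_time_search_def
proof (intro exI[of _ "compile p"] exI[of _ "time_poly p"] allI impI)
  fix n E
  assume "simple_graph {..<n} E" "P {..<n} E"
  moreover have "input_memory n E 0 0 = n" by (simp add: input_memory_def)
  ultimately show "\<exists>t s. exec (compile p) (input_memory n E) t s \<and>
      t \<le> poly (time_poly p) n \<and> R {..<n} E (output_set n s)"
    using exec_compile[OF assms(1)] assms(2) by blast
qed

text \<open>The invariant rule for loops. \<open>P j\<close> speaks about the memory before the
  counter is set to \<open>j\<close>, so each use has to show that it survives this write.\<close>

lemma sem_PFor_rule:
  assumes "P 0 s"
    and "\<And>j s. j < n \<Longrightarrow> P j s \<Longrightarrow> P (Suc j) (sem n p (put i j s))"
    and "\<And>s. P n s \<Longrightarrow> Q (put i n s)"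
  shows "Q (sem n (PFor i p) s)"
proof -
  have "P k (fold (\<lambda>j s. sem n p (put i j s)) [0..<k] s)" if "k \<le> n" for k
    using that by (induction k) (use assms in auto)
  then show ?thesis using assms(3) by simp
qed


section \<open>Loop schemes\<close>

definition cmap :: "nat \<Rightarrow> bexp \<Rightarrow> nat \<Rightarrow> aexp \<Rightarrow> prog" where
  "cmap i b a e = PFor i (PIf b (PStore a (Var i) e))"

text \<open>Each iteration writes only its own cell of \<open>a\<close>. Besides agreeing with
  \<open>s\<close> outside \<open>i\<close> and \<open>a\<close>, the memory \<open>s'\<close> still
  has the old value in the cell about to be written, so \<open>b\<close> and \<open>e\<close> may
  read that cell.\<close>

lemma sem_cmap:
  assumes "i \<noteq> a"
    and "\<And>s'. (\<And>x. x \<notin> {i, a} \<Longrightarrow> s' x = s x) \<Longrightarrow> s' i 0 < n \<Longrightarrow> s' a (s' i 0) = s a (s' i 0) \<Longrightarrow>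
      bval b s' = P (s' i 0) \<and> (P (s' i 0) \<longrightarrow> aval e s' = F (s' i 0))"
  shows "sem n (cmap i b a e) s a k = (if k < n \<and> P k then F k else s a k)"
proof -
  have "(\<lambda>t. t a = (\<lambda>k. if k < n \<and> P k then F k else s a k)) (sem n (cmap i b a e) s)"
    unfolding cmap_def
  proof (rule sem_PFor_rule[where P = "\<lambda>j t. (\<forall>x. x \<notin> {i, a} \<longrightarrow> t x = s x) \<and>
      t a = (\<lambda>k. if k < j \<and> P k then F k else s a k)"], goal_cases)
    case (2 j t)
    let ?t = "put i j t"
    have "bval b ?t = P (?t i 0) \<and> (P (?t i 0) \<longrightarrow> aval e ?t = F (?t i 0))"
      by (rule assms(2)) (use 2 assms(1) in auto)
    then show ?case using 2 assms(1) by (auto simp: fun_eq_iff less_Suc_eq)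
  qed (use assms(1) in auto)
  then show ?thesis by simp
qed

definition mark :: "nat \<Rightarrow> nat \<Rightarrow> bexp \<Rightarrow> nat \<Rightarrow> aexp \<Rightarrow> nat \<Rightarrow> prog" where
  "mark i j b a e c = PFor i (PFor j (PIf b (PStore a e (Const c))))"

lemma sem_mark:
  assumes "i \<noteq> a" "j \<noteq> a" "i \<noteq> j"
    and "\<And>s'. (\<And>x. x \<notin> {i, j, a} \<Longrightarrow> s' x = s x) \<Longrightarrow> s' i 0 < n \<Longrightarrow> s' j 0 < n \<Longrightarrow>
      bval b s' = P (s' i 0) (s' j 0) \<and> aval e s' = F (s' i 0) (s' j 0)"
  shows "sem n (mark i j b a e c) s a k =
    (if \<exists>u<n. \<exists>v<n. P u v \<and> F u v = k then c else s a k)"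
proof -
  have inner: "(\<lambda>t. (\<forall>x. x \<notin> {i, j, a} \<longrightarrow> t x = s x) \<and>
        (\<forall>k. t a k = (if \<exists>v<n. P u v \<and> F u v = k then c else g k)))
      (sem n (PFor j (PIf b (PStore a e (Const c)))) s0)"
    if s0: "\<forall>x. x \<notin> {i, j, a} \<longrightarrow> s0 x = s x" "s0 i 0 = u" "u < n" "s0 a = g" for s0 u g
  proof (rule sem_PFor_rule[where P = "\<lambda>v' t. (\<forall>x. x \<notin> {i, j, a} \<longrightarrow> t x = s x) \<and> t i 0 = u \<and>
        (\<forall>k. t a k = (if \<exists>v<v'. P u v \<and> F u v = k then c else g k))"], goal_cases)
    case (2 v t)
    let ?t = "put j v t"
    have "bval b ?t = P (?t i 0) (?t j 0) \<and> aval e ?t = F (?t i 0) (?t j 0)"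
      by (rule assms(4)) (use 2 s0 assms in auto)
    then have be: "bval b ?t = P u v" "aval e ?t = F u v" using 2 assms by auto
    show ?case
    proof (cases "P u v")
      case True
      then show ?thesis using 2 assms be by (auto simp: less_Suc_eq)
    next
      case False
      then have "(\<exists>v'<Suc v. P u v' \<and> F u v' = k) \<longleftrightarrow> (\<exists>v'<v. P u v' \<and> F u v' = k)" for k
        by (auto simp: less_Suc_eq)
      then show ?thesis using 2 assms be False by auto
    qed
  qed (use assms s0 in auto)
  have "(\<lambda>t. \<forall>k. t a k = (if \<exists>u<n. \<exists>v<n. P u v \<and> F u v = k then c else s a k))
      (sem n (mark i j b a e c) s)"
    unfolding mark_def
  proof (rule sem_PFor_rule[where P = "\<lambda>u' t. (\<forall>x. x \<notin> {i, j, a} \<longrightarrow> t x = s x) \<and>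
        (\<forall>k. t a k = (if \<exists>u<u'. \<exists>v<n. P u v \<and> F u v = k then c else s a k))"], goal_cases)
    case (2 u t)
    have "(\<forall>x. x \<notin> {i, j, a} \<longrightarrow> sem n (PFor j (PIf b (PStore a e (Const c)))) (put i u t) x = s x) \<and>
        (\<forall>k. sem n (PFor j (PIf b (PStore a e (Const c)))) (put i u t) a k =
          (if \<exists>v<n. P u v \<and> F u v = k then c else t a k))"
      by (rule inner) (use 2 assms in auto)
    moreover have "(\<exists>u'<Suc u. \<exists>v<n. P u' v \<and> F u' v = k) \<longleftrightarrow>
        (\<exists>u'<u. \<exists>v<n. P u' v \<and> F u' v = k) \<or> (\<exists>v<n. P u v \<and> F u v = k)" for k
      by (auto simp: less_Suc_eq)
    ultimately show ?case using 2 by auto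
  qed (use assms in auto)
  then show ?thesis by simp
qed

definition any2 :: "nat \<Rightarrow> nat \<Rightarrow> bexp \<Rightarrow> nat \<Rightarrow> prog" where
  "any2 i j b a = PSeq (PStore a (Const 0) (Const 0)) (mark i j b a (Const 0) 1)"

lemma sem_any2:
  assumes "i \<noteq> a" "j \<noteq> a" "i \<noteq> j"
    and "\<And>s'. (\<And>x. x \<notin> {i, j, a} \<Longrightarrow> s' x = s x) \<Longrightarrow> s' i 0 < n \<Longrightarrow> s' j 0 < n \<Longrightarrow>
      bval b s' = P (s' i 0) (s' j 0)"
  shows "sem n (any2 i j b a) s a 0 = (if \<exists>u<n. \<exists>v<n. P u v then 1 else 0)"
proof -
  have "sem n (mark i j b a (Const 0) 1) (put a 0 s) a 0 =
      (if \<exists>u<n. \<exists>v<n. P u v \<and> 0 = (0::nat) then 1 else put a 0 s a 0)"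
  proof (rule sem_mark[OF assms(1-3)], rule conjI)
    fix s' assume "\<And>x. x \<notin> {i, j, a} \<Longrightarrow> s' x = put a 0 s x" "s' i 0 < n" "s' j 0 < n"
    then show "bval b s' = P (s' i 0) (s' j 0)"
      by (intro assms(4)) auto
  qed simp
  then show ?thesis by (simp add: any2_def)
qed

definition count_if :: "nat \<Rightarrow> bexp \<Rightarrow> nat \<Rightarrow> prog" where
  "count_if i b a = PSeq (PStore a (Const 0) (Const 0))
     (PFor i (PIf b (PStore a (Const 0) (Plus (Var a) (Const 1)))))"

lemma sem_count_if:
  assumes "i \<noteq> a"
    and "\<And>s'. (\<And>x. x \<notin> {i, a} \<Longrightarrow> s' x = s x) \<Longrightarrow> s' i 0 < n \<Longrightarrow> bval b s' = P (s' i 0)"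
  shows "sem n (count_if i b a) s a 0 = card {v. v < n \<and> P v}"
proof -
  have "(\<lambda>t. t a 0 = card {v. v < n \<and> P v})
      (sem n (PFor i (PIf b (PStore a (Const 0) (Plus (Var a) (Const 1))))) (put a 0 s))"
  proof (rule sem_PFor_rule[where P = "\<lambda>j t. (\<forall>x. x \<notin> {i, a} \<longrightarrow> t x = s x) \<and>
      t a 0 = card {v. v < j \<and> P v}"], goal_cases)
    case (2 j t)
    let ?t = "put i j t"
    have "bval b ?t = P (?t i 0)"
      by (rule assms(2)) (use 2 in auto)
    moreover have "{v. v < Suc j \<and> P v} = (if P j then insert j {v. v < j \<and> P v} else {v. v < j \<and> P v})"
      by (auto simp: less_Suc_eq)
    ultimately show ?case using 2 assms(1) by auto
  qed (use assms in auto)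
  then show ?thesis by (simp add: count_if_def)
qed

definition argmin :: "nat \<Rightarrow> nat \<Rightarrow> bexp \<Rightarrow> aexp \<Rightarrow> aexp \<Rightarrow> nat \<Rightarrow> nat \<Rightarrow> nat \<Rightarrow> prog" where
  "argmin i j b e e0 x y z = PSeq (PStore z (Const 0) e0)
     (PFor i (PFor j (PIf (Conj b (Less e (Var z)))
       (PSeq (PStore z (Const 0) e)
         (PSeq (PStore x (Const 0) (Var i)) (PStore y (Const 0) (Var j)))))))"

text \<open>\<open>c\<close> caps the minimum: \<open>m = c\<close> signals that no admissible pair
  costs less than \<open>c\<close>, and then \<open>u\<close> and \<open>v\<close> carry no
  information.\<close>

definition is_argmin ::
  "nat \<Rightarrow> (nat \<Rightarrow> nat \<Rightarrow> bool) \<Rightarrow> (nat \<Rightarrow> nat \<Rightarrow> nat) \<Rightarrow> nat \<Rightarrow> nat \<Rightarrow> nat \<Rightarrow> nat \<Rightarrow> bool" where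
  "is_argmin n P F c u v m \<longleftrightarrow>
     m \<le> c \<and> (m < c \<longrightarrow> u < n \<and> v < n \<and> P u v \<and> F u v = m) \<and>
     (\<forall>u<n. \<forall>v<n. P u v \<longrightarrow> m \<le> F u v)"

lemma sem_argmin:
  assumes "distinct [i, j, x, y, z]"
    and "\<And>s'. (\<And>a. a \<notin> {i, j, x, y, z} \<Longrightarrow> s' a = s a) \<Longrightarrow> s' i 0 < n \<Longrightarrow> s' j 0 < n \<Longrightarrow>
      bval b s' = P (s' i 0) (s' j 0) \<and> (P (s' i 0) (s' j 0) \<longrightarrow> aval e s' = F (s' i 0) (s' j 0))"
    and c: "aval e0 s = c"
  shows "is_argmin n P F c (sem n (argmin i j b e e0 x y z) s x 0)
    (sem n (argmin i j b e e0 x y z) s y 0) (sem n (argmin i j b e e0 x y z) s z 0)"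
proof -
  define body where "body = PIf (Conj b (Less e (Var z)))
       (PSeq (PStore z (Const 0) e)
         (PSeq (PStore x (Const 0) (Var i)) (PStore y (Const 0) (Var j))))"
  have written_body: "written body = {x, y, z}" unfolding body_def by auto
  \<comment> \<open>\<open>S\<close> is the set of pairs already visited, so that the two loops
    merely enlarge \<open>S\<close>.\<close>
  define I where "I = (\<lambda>S t. (\<forall>a. a \<notin> {i, j, x, y, z} \<longrightarrow> t a = s a) \<and>
      t z 0 \<le> c \<and> (t z 0 < c \<longrightarrow> t x 0 < n \<and> t y 0 < n \<and> P (t x 0) (t y 0) \<and> F (t x 0) (t y 0) = t z 0) \<and>
      (\<forall>(u, v) \<in> S. P u v \<longrightarrow> t z 0 \<le> F u v))"
  have step: "I (insert (u, v) S) (sem n body t)"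
    if "I S t" "t i 0 = u" "t j 0 = v" "u < n" "v < n" for S t u v
  proof -
    have "bval b t = P (t i 0) (t j 0) \<and> (P (t i 0) (t j 0) \<longrightarrow> aval e t = F (t i 0) (t j 0))"
      by (rule assms(2)) (use that in \<open>auto simp: I_def\<close>)
    then have be: "bval b t = P u v" "P u v \<Longrightarrow> aval e t = F u v" using that by auto
    show ?thesis
    proof (cases "P u v \<and> F u v < t z 0")
      case True
      define t' where "t' = sem n body t"
      have "t' z 0 = F u v" "t' x 0 = u" "t' y 0 = v" "\<forall>a. a \<notin> {x, y, z} \<longrightarrow> t' a = t a"
        using True be that assms(1) unfolding t'_def body_def by auto
      moreover have "F u v \<le> F u' v'" if "(u', v') \<in> S" "P u' v'" for u' v'
        using \<open>I S t\<close> True that unfolding I_def by fastforce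
      ultimately show ?thesis using True that unfolding I_def t'_def[symmetric] by auto
    next
      case False
      then have "sem n body t = t" using be unfolding body_def by auto
      then show ?thesis using False that unfolding I_def by auto
    qed
  qed
  have inner: "(\<lambda>t. I (S \<union> {u} \<times> {..<n}) t) (sem n (PFor j body) t0)"
    if t0: "I S t0" "t0 i 0 = u" "u < n" for S t0 u
  proof (rule sem_PFor_rule[where P = "\<lambda>v t. I (S \<union> {u} \<times> {..<v}) t \<and> t i 0 = u"], goal_cases)
    case (2 v t)
    have "I (S \<union> {u} \<times> {..<v}) (put j v t)" using 2 assms(1) unfolding I_def by auto
    then have "I (insert (u, v) (S \<union> {u} \<times> {..<v})) (sem n body (put j v t))"
      by (rule step) (use 2 that assms(1) in auto)
    moreover have "insert (u, v) (S \<union> {u} \<times> {..<v}) = S \<union> {u} \<times> {..<Suc v}"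
      by (auto simp: less_Suc_eq)
    moreover have "sem n body (put j v t) i = put j v t i"
      by (rule sem_frame) (use assms(1) in \<open>simp add: written_body\<close>)
    ultimately show ?case using 2 assms(1) by auto
  next
    case (3 t)
    then show ?case using assms(1) unfolding I_def by auto
  qed (use t0 in auto)
  have "(\<lambda>t. I ({..<n} \<times> {..<n}) t) (sem n (PFor i (PFor j body)) (put z c s))"
  proof (rule sem_PFor_rule[where P = "\<lambda>u t. I ({..<u} \<times> {..<n}) t"], goal_cases)
    case 1
    then show ?case using assms(1) unfolding I_def by auto
  next
    case (2 u t)
    have "I ({..<u} \<times> {..<n} \<union> {u} \<times> {..<n}) (sem n (PFor j body) (put i u t))"
      by (rule inner) (use 2 assms(1) in \<open>auto simp: I_def\<close>)
    moreover have "{..<u} \<times> {..<n} \<union> {u} \<times> {..<n} = {..<Suc u} \<times> {..<n}"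
      by (auto simp: less_Suc_eq)
    ultimately show ?case by simp
  next
    case (3 t)
    then show ?case using assms(1) unfolding I_def by auto
  qed
  then show ?thesis unfolding I_def is_argmin_def argmin_def body_def by (auto simp: c)
qed

text \<open>The counters of \<open>nest k p\<close> are the arrays from 30 on; no other array number exceeds 26.\<close>

fun nest :: "nat \<Rightarrow> prog \<Rightarrow> prog" where
  "nest 0 p = p"
| "nest (Suc k) p = PFor (30 + k) (nest k p)"

lemma written_nest: "written (nest k p) = written p \<union> {30..<30 + k}"
  by (induction k) auto

lemma wf_prog_nest: "wf_prog p \<Longrightarrow> written p \<inter> {30..} = {} \<Longrightarrow> wf_prog (nest k p)"
  by (induction k) (auto simp: written_nest)

lemma sem_nest_inv:
  assumes "\<And>s k x. I s \<Longrightarrow> I (put (30 + k) x s)" "\<And>s. I s \<Longrightarrow> I (sem n p s)" "I s"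
  shows "I (sem n (nest k p) s)"
  using assms(3)
proof (induction k arbitrary: s)
  case 0
  then show ?case by (simp add: assms)
next
  case (Suc k)
  show ?case unfolding nest.simps
  proof (rule sem_PFor_rule[where P = "\<lambda>_. I" and Q = I], goal_cases)
    case (2 j t)
    show ?case by (rule Suc.IH, rule assms(1), rule 2(2))
  qed (rule Suc.prems, rule assms(1))
qed

text \<open>The nested counters run through all \<open>k\<close>-tuples below \<open>n\<close>, so
  at some moment they form \<open>f\<close>; then \<open>p\<close> establishes \<open>Q\<close>, and
  later runs keep it. \<open>I\<close> holds throughout.\<close>

lemma sem_nest_hit:
  assumes put: "\<And>s k x. I s \<Longrightarrow> I (put (30 + k) x s)" "\<And>s k x. Q s \<Longrightarrow> Q (put (30 + k) x s)"
    and inv: "\<And>s. I s \<Longrightarrow> I (sem n p s)"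
    and keep: "\<And>s. I s \<Longrightarrow> Q s \<Longrightarrow> Q (sem n p s)"
    and hit: "\<And>s. I s \<Longrightarrow> \<forall>j<k. s (30 + j) 0 = f j \<Longrightarrow> Q (sem n p s)"
    and p: "written p \<inter> {30..} = {}" and f: "\<forall>j<k. f j < n"
    and s: "I s"
  shows "Q (sem n (nest k p) s)"
proof -
  have I: "I (sem n (nest m p) s)" if "I s" for m s
    by (rule sem_nest_inv[where I = I, OF put(1) inv that])
  have Q: "I (sem n (nest m p) s) \<and> Q (sem n (nest m p) s)" if "I s" "Q s" for m s
    by (rule sem_nest_inv[where I = "\<lambda>s. I s \<and> Q s"])
      (use put[of _ ] inv keep that in \<open>blast+\<close>)
  \<comment> \<open>Induction on the number \<open>m\<close> of loops still to be entered, the outer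
    counters standing at their values in \<open>f\<close>. Within a loop, \<open>Q\<close> holds
    once its counter has passed \<open>f m\<close>.\<close>
  have "Q (sem n (nest m p) s)"
    if "m \<le> k" "I s" "\<forall>j. m \<le> j \<longrightarrow> j < k \<longrightarrow> s (30 + j) 0 = f j" for m s
    using that
  proof (induction m arbitrary: s)
    case 0
    then show ?case using hit by simp
  next
    case (Suc m)
    show ?case unfolding nest.simps
    proof (rule sem_PFor_rule[where Q = Q and P = "\<lambda>i t. I t \<and> (f m < i \<longrightarrow> Q t) \<and>
        (\<forall>j. Suc m \<le> j \<longrightarrow> j < k \<longrightarrow> t (30 + j) 0 = f j)"], goal_cases)
      case (2 i t)
      let ?t = "put (30 + m) i t"
      have t: "I ?t" "Q t \<Longrightarrow> Q ?t" using put(1)[of t m i] put(2)[of t m i] 2(2) by simp_all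
      have "sem n (nest m p) ?t (30 + j) = ?t (30 + j)" if "m \<le> j" for j
        by (rule sem_frame) (use p that in \<open>auto simp: written_nest\<close>)
      moreover have "Q (sem n (nest m p) ?t)" if "i = f m"
      proof (rule Suc.IH)
        show "m \<le> k" using Suc.prems by simp
        show "\<forall>j. m \<le> j \<longrightarrow> j < k \<longrightarrow> ?t (30 + j) 0 = f j"
        proof (intro allI impI)
          fix j assume "m \<le> j" "j < k"
          then show "?t (30 + j) 0 = f j"
            using 2 that by (cases "j = m") simp_all
        qed
      qed (rule t)
      moreover have "Q (sem n (nest m p) ?t)" if "f m < i"
        using Q t 2 that by blast
      ultimately show ?case using I[OF t(1)] 2
        by (auto simp: less_Suc_eq)
    next
      case (3 t)
      have "f m < n" using f Suc.prems by simp
      then show ?case using put(2)[of t] 3 by simp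
    qed (use Suc.prems in simp)
  qed
  from this[of k] show ?thesis using s by simp
qed

fun store_tuple :: "nat \<Rightarrow> nat \<Rightarrow> (aexp \<Rightarrow> aexp) \<Rightarrow> prog" where
  "store_tuple 0 a e = PStore a (Var 30) (e (Var 30))"
| "store_tuple (Suc k) a e =
     PSeq (store_tuple k a e) (PStore a (Var (30 + Suc k)) (e (Var (30 + Suc k))))"

lemma written_store_tuple: "written (store_tuple k a e) = {a}"
  by (induction k) auto

lemma wf_prog_store_tuple: "a \<noteq> 0 \<Longrightarrow> wf_prog (store_tuple k a e)"
  by (induction k) auto

text \<open>The tuple has \<open>Suc k\<close> entries. Repeated entries do no harm: the value
  written at \<open>v\<close> is computed without reading \<open>a\<close>, hence is the same each
  time.\<close>

lemma sem_store_tuple: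
  assumes "a < 30" "\<And>s' x. (\<And>b. b \<noteq> a \<Longrightarrow> s' b = s b) \<Longrightarrow> aval (e (Var x)) s' = F (aval (Var x) s')"
  shows "sem n (store_tuple k a e) s a v =
    (if \<exists>j<Suc k. s (30 + j) 0 = v then F v else s a v)"
proof (induction k arbitrary: v)
  case 0
  show ?case using assms by auto
next
  case (Suc k)
  let ?t = "sem n (store_tuple k a e) s"
  have t: "?t b = s b" if "b \<noteq> a" for b
    by (rule sem_frame) (use that in \<open>simp add: written_store_tuple\<close>)
  have "aval (e (Var (30 + Suc k))) ?t = F (aval (Var (30 + Suc k)) ?t)"
    by (rule assms(2)) (rule t)
  moreover have "?t (30 + Suc k) 0 = s (30 + Suc k) 0" using assms(1) by (simp add: t)
  moreover have "(\<exists>j<Suc (Suc k). s (30 + j) 0 = v) \<longleftrightarrow>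
      (\<exists>j<Suc k. s (30 + j) 0 = v) \<or> s (30 + Suc k) 0 = v"
    using less_Suc_eq by auto
  ultimately show ?case using Suc by auto
qed

section \<open>Bipartite induced subgraphs\<close>

definition bipartite_on :: "'a set set \<Rightarrow> 'a set \<Rightarrow> bool" where
  "bipartite_on E S \<longleftrightarrow> (\<exists>c. \<forall>u\<in>S. \<forall>v\<in>S. {u, v} \<in> E \<longrightarrow> c u \<noteq> (c v :: bool))"

definition toggle :: "nat \<Rightarrow> nat set \<Rightarrow> nat set \<Rightarrow> nat set" where
  "toggle n S T = {v. v < n \<and> (v \<in> S) \<noteq> (v \<in> T)}"

text \<open>Tuples may repeat entries, so for positive \<open>k\<close> they describe exactly the
  nonempty exchange sets of at most \<open>k\<close> vertices. This is what nested loops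
  enumerate.\<close>

definition locally_maximum :: "nat \<Rightarrow> nat set set \<Rightarrow> nat \<Rightarrow> nat set \<Rightarrow> bool" where
  "locally_maximum n E k S \<longleftrightarrow> (\<forall>f. (\<forall>j<k. f j < n) \<longrightarrow>
     bipartite_on E (toggle n S (f ` {..<k})) \<longrightarrow> card (toggle n S (f ` {..<k})) \<le> card S)"

lemma bipartite_on_subset: "bipartite_on E S \<Longrightarrow> T \<subseteq> S \<Longrightarrow> bipartite_on E T"
proof -
  assume "bipartite_on E S" "T \<subseteq> S"
  then obtain c where c: "\<forall>u\<in>S. \<forall>v\<in>S. {u, v} \<in> E \<longrightarrow> c u \<noteq> (c v :: bool)"
    unfolding bipartite_on_def by (elim exE)
  show ?thesis
    unfolding bipartite_on_def
  proof (intro exI[of _ c] ballI)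
    fix u v assume "u \<in> T" "v \<in> T"
    then have "u \<in> S" "v \<in> S" using \<open>T \<subseteq> S\<close> by auto
    then show "{u, v} \<in> E \<longrightarrow> c u \<noteq> c v" using c by simp
  qed
qed

text \<open>An enumeration is padded to length \<open>k\<close> by repeating its first element; this
  is where \<open>T\<close> has to be nonempty.\<close>

lemma tuple_of_set:
  assumes "finite T" "T \<noteq> {}" "card T \<le> k"
  obtains f :: "nat \<Rightarrow> 'a" where "f ` {..<k} = T"
proof -
  obtain g where g: "bij_betw g {0..<card T} T"
    using ex_bij_betw_nat_finite[OF assms(1)] by blast
  have "0 < card T" using assms by (simp add: card_gt_0_iff)
  have gT: "g ` {0..<card T} = T" using g unfolding bij_betw_def by simp
  have "(\<lambda>j. if j < card T then g j else g 0) ` {..<k} = T" (is "?f ` _ = _")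
  proof
    show "?f ` {..<k} \<subseteq> T" using \<open>0 < card T\<close> gT by auto
    have "g j \<in> ?f ` {..<k}" if "j < card T" for j
      using that assms(3) by (intro image_eqI[of _ _ j]) auto
    then have "g ` {0..<card T} \<subseteq> ?f ` {..<k}" by (intro image_subsetI) simp
    then show "T \<subseteq> ?f ` {..<k}" using gT by simp
  qed
  then show ?thesis using that by blast
qed

text \<open>Two distinct vertices of an independent set never share a clique, so each
  \<open>B j\<close> contributes at most one.\<close>

lemma card_Int_cliques_le:
  assumes "independent_set V E S" "\<forall>j<l. clique V E (B j)" "finite V"
  shows "card (S \<inter> (\<Union>j<l. B j)) \<le> l"
proof -
  have "card (S \<inter> B j) \<le> 1" if "j < l" for j
  proof -
    have "\<forall>x\<in>S \<inter> B j. \<forall>y\<in>S \<inter> B j. x = y"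
      using assms that unfolding independent_set_def clique_def by blast
    moreover have "finite (S \<inter> B j)"
      using assms unfolding independent_set_def by (meson finite_Int finite_subset)
    ultimately show ?thesis
      by (metis card_le_Suc0_iff_eq One_nat_def)
  qed
  then have "(\<Sum>j<l. card (S \<inter> B j)) \<le> (\<Sum>j<l. 1)"
    by (intro sum_mono) auto
  moreover have "card (\<Union>j<l. S \<inter> B j) \<le> (\<Sum>j<l. card (S \<inter> B j))"
    by (rule card_UN_le) simp
  ultimately show ?thesis by simp
qed

text \<open>Each of the two colour classes is independent and so has at most \<open>l\<close>
  vertices in the cliques.\<close>

lemma card_bipartite_Int_cliques_le:
  assumes "bipartite_on E S" "S \<subseteq> V" "\<forall>j<l. clique V E (B j)" "finite V"
  shows "card (S \<inter> (\<Union>j<l. B j)) \<le> 2 * l"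
proof -
  obtain c where c: "\<forall>u\<in>S. \<forall>v\<in>S. {u, v} \<in> E \<longrightarrow> c u \<noteq> (c v :: bool)"
    using assms unfolding bipartite_on_def by blast
  let ?D = "\<Union>j<l. B j" and ?S = "\<lambda>b. {u \<in> S. c u = b}"
  have "independent_set V E (?S b)" for b
    using c assms(2) unfolding independent_set_def by blast
  then have "card (?S b \<inter> ?D) \<le> l" for b
    using card_Int_cliques_le assms by blast
  from this[of True] this[of False]
  have "card (?S True \<inter> ?D) + card (?S False \<inter> ?D) \<le> 2 * l" by simp
  moreover have "S \<inter> ?D = (?S True \<inter> ?D) \<union> (?S False \<inter> ?D)" by auto
  ultimately show ?thesis
    using card_Un_le[of "?S True \<inter> ?D" "?S False \<inter> ?D"] by simp
qed

lemma bipartite_on_kl_partition: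
  assumes "kl_partition 2 l V E A B"
  shows "bipartite_on E (\<Union>i<2. A i)"
proof -
  have "(\<Union>i<2. A i) = A 0 \<union> A (1::nat)" by (auto simp: less_2_cases_iff)
  moreover have "independent_set V E (A 0)" "independent_set V E (A 1)"
    using assms unfolding kl_partition_def by auto
  ultimately show ?thesis
    unfolding bipartite_on_def independent_set_def by (intro exI[of _ "\<lambda>u. u \<in> A 0"]) blast
qed

lemma locally_maximum_almost_contains:
  assumes kl: "kl_partition 2 l {..<n} E A B"
    and S: "S \<subseteq> {..<n}" "bipartite_on E S" "locally_maximum n E (4 * l + 1) S"
  shows "card ((\<Union>i<2. A i) - S) \<le> 2 * l"
proof (rule ccontr)
  define Z where "Z = (\<Union>i<2. A i)"
  define D where "D = (\<Union>j<l. B j)"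
  assume "\<not> card ((\<Union>i<2. A i) - S) \<le> 2 * l"
  then have large: "2 * l + 1 \<le> card (Z - S)" unfolding Z_def by simp
  have ZD: "Z \<inter> D = {}" "Z \<union> D = {..<n}" and cl: "\<forall>j<l. clique {..<n} E (B j)"
    using kl unfolding kl_partition_def Z_def D_def by auto
  have fin: "finite Z" "finite D" "finite S"
    using ZD S(1) by (metis finite_Un finite_lessThan, metis finite_Un finite_lessThan, metis finite_subset finite_lessThan)
  have SD: "card (S \<inter> D) \<le> 2 * l"
    using card_bipartite_Int_cliques_le[OF S(2,1) cl] unfolding D_def by simp
  then have "card (S \<inter> D) + 1 \<le> card (Z - S)" using large by simp
  then obtain Y where Y: "Y \<subseteq> Z - S" "card Y = card (S \<inter> D) + 1"
    by (metis obtain_subset_with_card_n)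
  have finY: "finite Y" using Y fin by (meson finite_Diff finite_subset)
  \<comment> \<open>The exchange drops at most \<open>2 * l\<close> vertices, those of
    \<open>S\<close> in \<open>D\<close>, and adds one more than it drops, all from
    \<open>Z\<close>; hence the constant \<open>4 * l + 1\<close>. The new set lies inside
    \<open>Z\<close> and is bipartite for that reason.\<close>
  let ?T = "(S \<inter> D) \<union> Y"
  have "card ?T \<le> 4 * l + 1" using card_Un_le[of "S \<inter> D" Y] Y SD by simp
  moreover have "?T \<noteq> {}" using Y(2) by auto
  ultimately obtain f where f: "f ` {..<4 * l + 1} = ?T"
    using tuple_of_set[of ?T] fin finY by blast
  have tog: "toggle n S ?T = (S - D) \<union> Y"
    using Y(1) ZD S(1) unfolding toggle_def by auto
  have "bipartite_on E (toggle n S ?T)"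
    unfolding tog
  proof (rule bipartite_on_subset)
    show "bipartite_on E Z" using bipartite_on_kl_partition[OF kl] unfolding Z_def .
    show "S - D \<union> Y \<subseteq> Z" using Y(1) ZD S(1) by auto
  qed
  moreover have "\<forall>j<4 * l + 1. f j < n"
  proof (intro allI impI)
    fix j assume "j < 4 * l + 1"
    then have "f j \<in> ?T" using f by blast
    then show "f j < n" using Y(1) ZD by blast
  qed
  ultimately have "card ((S - D) \<union> Y) \<le> card S"
    using S(3) f tog unfolding locally_maximum_def by metis
  moreover have "card ((S - D) \<union> Y) = card (S - D) + card Y"
    by (rule card_Un_disjoint) (use fin finY Y in auto)
  moreover have "card S = card (S - D) + card (S \<inter> D)"
    using fin by (metis add.commute card_Diff_subset_Int card_Int_Diff finite_Int)
  ultimately show False using Y(2) by simp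
qed


section \<open>Auctions for bipartite matching\<close>

text \<open>
  \<open>m u = Suc r\<close> means that \<open>u\<close> holds \<open>r\<close>, and \<open>m u = 0\<close> that \<open>u\<close> holds nothing; \<open>d r\<close> is the
  price of \<open>r\<close>.
\<close>

definition auction_inv ::
  "nat \<Rightarrow> nat set set \<Rightarrow> nat set \<Rightarrow> nat set \<Rightarrow> (nat \<Rightarrow> nat) \<Rightarrow> (nat \<Rightarrow> nat) \<Rightarrow> bool" where
  "auction_inv n E L R m d \<longleftrightarrow>
     (\<forall>u<n. \<forall>r. m u = Suc r \<longrightarrow> u \<in> L \<and> r \<in> R \<and> {u, r} \<in> E) \<and>
     (\<forall>u<n. \<forall>v<n. \<forall>r. m u = Suc r \<longrightarrow> m v = Suc r \<longrightarrow> u = v) \<and>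
     (\<forall>r\<in>R. 0 < d r \<longrightarrow> (\<exists>u<n. m u = Suc r)) \<and>
     (\<forall>u<n. \<forall>r. \<forall>q\<in>R. m u = Suc r \<longrightarrow> {u, q} \<in> E \<longrightarrow> d r \<le> d q + 1) \<and>
     (\<forall>r<n. d r \<le> n)"

definition auction_done :: "nat \<Rightarrow> nat set set \<Rightarrow> nat set \<Rightarrow> nat set \<Rightarrow> (nat \<Rightarrow> nat) \<Rightarrow> (nat \<Rightarrow> nat) \<Rightarrow> bool" where
  "auction_done n E L R m d \<longleftrightarrow> (\<forall>u\<in>L. \<forall>r\<in>R. m u = 0 \<longrightarrow> {u, r} \<in> E \<longrightarrow> n \<le> d r)"

text \<open>If the auction is done and \<open>k\<close> is positive, at most \<open>n\<close> and
  not a price, the rest of \<open>L\<close> and \<open>R\<close> is a vertex cover as in Koenig's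
  theorem, with one end of each matched pair. The subtraction in \<open>m u - 1\<close> undoes the
  encoding of the held item.\<close>

definition threshold_set :: "nat set \<Rightarrow> nat set \<Rightarrow> (nat \<Rightarrow> nat) \<Rightarrow> (nat \<Rightarrow> nat) \<Rightarrow> nat \<Rightarrow> nat set" where
  "threshold_set L R m d k = {u \<in> L. m u = 0 \<or> k < d (m u - 1)} \<union> {r \<in> R. d r < k}"

lemma auction_invD:
  assumes "auction_inv n E L R m d" "u < n" "m u = Suc r"
  shows "u \<in> L" "r \<in> R" "{u, r} \<in> E"
    and "v < n \<Longrightarrow> m v = Suc r \<Longrightarrow> u = v"
    and "q \<in> R \<Longrightarrow> {u, q} \<in> E \<Longrightarrow> d r \<le> d q + 1"
proof -
  note inv = assms(1)[unfolded auction_inv_def]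
  show "u \<in> L" "r \<in> R" "{u, r} \<in> E"
    using inv[THEN conjunct1] assms(2,3) by blast+
  show "v < n \<Longrightarrow> m v = Suc r \<Longrightarrow> u = v"
    using inv[THEN conjunct2, THEN conjunct1] assms(2,3) by blast
  show "q \<in> R \<Longrightarrow> {u, q} \<in> E \<Longrightarrow> d r \<le> d q + 1"
    using inv[THEN conjunct2, THEN conjunct2, THEN conjunct2, THEN conjunct1] assms(2,3) by blast
qed

lemma auction_inv_held:
  "auction_inv n E L R m d \<Longrightarrow> q \<in> R \<Longrightarrow> 0 < d q \<Longrightarrow> \<exists>v<n. m v = Suc q"
  by (simp add: auction_inv_def)

lemma auction_inv_le: "auction_inv n E L R m d \<Longrightarrow> r < n \<Longrightarrow> d r \<le> n"
  by (simp add: auction_inv_def)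

text \<open>The fourth clause of \<open>auction_inv\<close> is complementary slackness with error 1.
  It survives since \<open>u\<close> takes an item that was cheapest before the rise, while every
  other holder keeps its item at an unchanged price and alternatives only become dearer. Eviction
  leaves \<open>r\<close> held by \<open>u\<close> alone, so all items with a positive price stay
  held.\<close>

lemma auction_bid:
  assumes inv: "auction_inv n E L R m d"
    and LR: "L \<subseteq> {..<n}" "R \<subseteq> {..<n}"
    and u: "u \<in> L" "m u = 0" and r: "r \<in> R" "{u, r} \<in> E" "d r < n"
    and cheapest: "\<And>q. q \<in> R \<Longrightarrow> {u, q} \<in> E \<Longrightarrow> d r \<le> d q"
    and m': "\<And>v. v < n \<Longrightarrow> m' v = (if v = u then Suc r else if m v = Suc r then 0 else m v)"
    and d': "\<And>q. q < n \<Longrightarrow> d' q = (if q = r then d r + 1 else d q)"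
  shows "auction_inv n E L R m' d'"
proof -
  have m'E: "v = u \<and> q = r \<or> v \<noteq> u \<and> q \<noteq> r \<and> m v = Suc q" if "m' v = Suc q" "v < n" for v q
    using that m'[of v] by (auto split: if_splits)
  note held = auction_inv_held[OF inv]
  show ?thesis
    unfolding auction_inv_def
  proof (intro conjI allI impI ballI)
    fix v q assume v: "v < n" "m' v = Suc q"
    show "v \<in> L" "q \<in> R" "{v, q} \<in> E"
      using m'E[OF v(2,1)] auction_invD(1-3)[OF inv v(1)] u r by auto
  next
    fix v w q assume v: "v < n" "w < n" "m' v = Suc q" "m' w = Suc q"
    show "v = w"
      using m'E[OF v(3,1)] m'E[OF v(4,2)] auction_invD(4)[OF inv v(1) _ v(2)] by auto
  next
    fix q assume q: "q \<in> R" "0 < d' q"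
    then have "q < n" using LR by auto
    show "\<exists>v<n. m' v = Suc q"
    proof (cases "q = r")
      case True
      then show ?thesis using u LR m'[of u] by auto
    next
      case False
      then obtain v where "v < n" "m v = Suc q" using held q d' \<open>q < n\<close> by auto
      then show ?thesis using False u m'[of v] by (intro exI[of _ v]) auto
    qed
  next
    fix v p q assume *: "v < n" "q \<in> R" "m' v = Suc p" "{v, q} \<in> E"
    have "q < n" using * LR by auto
    show "d' p \<le> d' q + 1"
    proof (cases "v = u")
      case True
      then have "p = r" using m'E[OF *(3,1)] by auto
      moreover have "d r \<le> d q" using cheapest * True by auto
      ultimately show ?thesis using d'[of r] d'[of q] \<open>q < n\<close> r(1) LR by auto
    next
      case False
      then have p: "m v = Suc p" "p \<noteq> r" using m'E[OF *(3,1)] by auto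
      then have "d p \<le> d q + 1" "p < n"
        using auction_invD(5)[OF inv *(1) p(1) *(2,4)] auction_invD(2)[OF inv *(1) p(1)] LR by auto
      then show ?thesis using \<open>p \<noteq> r\<close> d'[of p] d'[of q] \<open>q < n\<close> by auto
    qed
  next
    fix q assume "q < n"
    then show "d' q \<le> n" using d'[of q] auction_inv_le[OF inv, of q] r by auto
  qed
qed

text \<open>
  If no item has price \<open>k\<close>, then no edge runs between a bidder above the threshold and an item
  below it, and every vertex outside the threshold set is matched into it.
\<close>

lemma auction_optimal:
  assumes inv: "auction_inv n E L R m d" and final: "auction_done n E L R m d"
    and LR: "L \<subseteq> {..<n}" "R \<subseteq> {..<n}" "L \<inter> R = {}" and n: "0 < n"
    and bip: "\<And>u v. u \<in> L \<union> R \<Longrightarrow> v \<in> L \<union> R \<Longrightarrow> {u, v} \<in> E \<Longrightarrow> (u \<in> L) \<noteq> (v \<in> L)"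
  shows "\<exists>k<n. independent_set {..<n} E (threshold_set L R m d (Suc k)) \<and>
    (\<forall>T\<subseteq>L \<union> R. independent_set {..<n} E T \<longrightarrow> card T \<le> card (threshold_set L R m d (Suc k)))"
proof -
  note held = auction_inv_held[OF inv]
  \<comment> \<open>Pigeonhole: if there are bidders, the items miss a vertex and have at most
    \<open>n - 1\<close> prices; without bidders no item is held, so all prices are 0.\<close>
  have "\<exists>k\<in>{1..n}. k \<notin> d ` R"
  proof (cases "L = {}")
    case True
    then have "d r = 0" if "r \<in> R" for r
      using held[OF that] auction_invD(1)[OF inv] by auto
    then show ?thesis using n by (intro bexI[of _ 1]) auto
  next
    case False
    then have "R \<subset> {..<n}" using LR by blast
    then have "card R < n" using psubset_card_mono[of "{..<n}" R] by simp
    then have "card (d ` R) < card {1..n}"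
      using card_image_le[of R d] LR(2) finite_subset[of R "{..<n}"] by fastforce
    then have "\<not> {1..n} \<subseteq> d ` R"
      using card_mono[of "d ` R" "{1..n}"] LR(2) finite_subset[of R "{..<n}"] by fastforce
    then show ?thesis by blast
  qed
  then obtain k where k0: "k \<in> {1..n}" "k \<notin> d ` R" by blast
  then have k: "1 \<le> k" "k \<le> n" and gap: "\<And>r. r \<in> R \<Longrightarrow> d r \<noteq> k" by auto
  define I where "I = threshold_set L R m d k"
  have sub: "I \<subseteq> L \<union> R" unfolding I_def threshold_set_def by auto
  \<comment> \<open>An unmatched bidder sees only prices of at least \<open>n\<close>, and a bidder
    whose item costs more than \<open>k\<close> sees, by slackness, only prices of at least
    \<open>k\<close>; items in \<open>I\<close> cost less than \<open>k\<close>.\<close>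
  have no_edge: False if "u \<in> I" "r \<in> I" "u \<in> L" "r \<in> R" "{u, r} \<in> E" for u r
  proof -
    have un: "u < n" and rk: "d r < k" using that LR unfolding I_def threshold_set_def by auto
    have "m u = 0 \<or> k < d (m u - 1)" using that LR unfolding I_def threshold_set_def by auto
    then show False
    proof
      assume "m u = 0"
      then have "n \<le> d r" using final that unfolding auction_done_def by blast
      then show False using rk k by simp
    next
      assume kd: "k < d (m u - 1)"
      show False
      proof (cases "m u")
        case 0
        then have "n \<le> d r" using final that unfolding auction_done_def by blast
        then show False using rk k by simp
      next
        case (Suc q)
        then have "d q \<le> d r + 1" using auction_invD(5)[OF inv un] that by blast
        then show False using Suc kd rk by simp
      qed
    qed
  qed
  have ind: "independent_set {..<n} E I"
    unfolding independent_set_def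
  proof (intro conjI ballI notI)
    show "I \<subseteq> {..<n}" using sub LR by auto
    fix u v assume uv: "u \<in> I" "v \<in> I" "{u, v} \<in> E"
    then have "(u \<in> L) \<noteq> (v \<in> L)" using bip sub by blast
    then show False
      using no_edge[of u v] no_edge[of v u] uv sub by (auto simp: insert_commute)
  qed
  have "card T \<le> card I" if T: "T \<subseteq> L \<union> R" "independent_set {..<n} E T" for T
  proof -
    have finT: "finite T" "finite I"
      using T(1) LR sub by (meson Un_least finite_lessThan finite_subset)+
    define holder where "holder = (\<lambda>r. SOME u. u < n \<and> m u = Suc r)"
    \<comment> \<open>\<open>h\<close> sends a vertex to its partner in the matching. It injects
      \<open>T - I\<close> into \<open>I - T\<close>: as the price \<open>k\<close> does not occur,
      exactly one end of each matched pair lies in \<open>I\<close>, and \<open>T\<close> cannot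
      contain both ends.\<close>
    define h where "h = (\<lambda>x. if x \<in> L then m x - 1 else holder x)"
    have holder: "holder r < n \<and> m (holder r) = Suc r" if "r \<in> R" "0 < d r" for r
    proof -
      have "\<exists>u. u < n \<and> m u = Suc r" using held[OF that] by blast
      then show ?thesis unfolding holder_def by (rule someI_ex)
    qed
    have hL: "m x = Suc (h x) \<and> h x \<in> R \<and> h x \<in> I \<and> h x \<notin> T" if "x \<in> T - I" "x \<in> L" for x
    proof -
      have "x < n" "m x \<noteq> 0" "d (m x - 1) \<le> k"
        using that LR unfolding I_def threshold_set_def by auto
      then obtain r where r: "m x = Suc r" "d r \<le> k" by (cases "m x") auto
      then have rR: "r \<in> R" "{x, r} \<in> E" using auction_invD[OF inv \<open>x < n\<close>] by auto
      then have "d r < k" using gap r(2) by (simp add: le_neq_implies_less)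
      then have "r \<in> I" using rR unfolding I_def threshold_set_def by simp
      moreover have "r \<notin> T" using T(2) rR that unfolding independent_set_def by blast
      ultimately show ?thesis using r rR that unfolding h_def by simp
    qed
    have hR: "h x < n \<and> m (h x) = Suc x \<and> h x \<in> L \<and> h x \<in> I \<and> h x \<notin> T"
      if "x \<in> T - I" "x \<notin> L" for x
    proof -
      have x: "x \<in> R" using that T by auto
      then have "k < d x" using that gap[OF x] unfolding I_def threshold_set_def by auto
      then have *: "holder x < n" "m (holder x) = Suc x" using holder[OF x] by auto
      then have "holder x \<in> L" "{holder x, x} \<in> E"
        using auction_invD(1,3)[OF inv *] by simp_all
      moreover have "holder x \<in> I"
        using * \<open>k < d x\<close> \<open>holder x \<in> L\<close> unfolding I_def threshold_set_def by simp
      moreover have "holder x \<notin> T"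
        using T(2) that \<open>{holder x, x} \<in> E\<close> unfolding independent_set_def by blast
      ultimately show ?thesis using * that unfolding h_def by simp
    qed
    have "inj_on h (T - I)"
    proof (rule inj_onI)
      fix x y assume xy: "x \<in> T - I" "y \<in> T - I" "h x = h y"
      have xyn: "x < n" "y < n" using xy T LR by auto
      show "x = y"
      proof (cases "x \<in> L"; cases "y \<in> L")
        assume "x \<in> L" "y \<in> L"
        then have "m x = Suc (h x)" "m y = Suc (h x)"
          using hL[OF xy(1)] hL[OF xy(2)] xy(3) by simp_all
        then show ?thesis by (rule auction_invD(4)[OF inv xyn(1) _ xyn(2)])
      next
        assume "x \<in> L" "y \<notin> L"
        then show ?thesis using hL[OF xy(1)] hR[OF xy(2)] xy(3) LR(3) by auto
      next
        assume "x \<notin> L" "y \<in> L"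
        then show ?thesis using hR[OF xy(1)] hL[OF xy(2)] xy(3) LR(3) by auto
      next
        assume "x \<notin> L" "y \<notin> L"
        then have "m (h x) = Suc x" "m (h y) = Suc y" using hR xy(1,2) by blast+
        then show ?thesis unfolding xy(3) by simp
      qed
    qed
    moreover have "h ` (T - I) \<subseteq> I - T" using hL hR by blast
    ultimately have "card (T - I) \<le> card (I - T)"
      using finT by (intro card_inj_on_le) auto
    moreover have "card T = card (T \<inter> I) + card (T - I)" "card I = card (T \<inter> I) + card (I - T)"
      using finT by (metis card_Int_Diff, metis card_Int_Diff inf_commute)
    ultimately show ?thesis by simp
  qed
  \<comment> \<open>The shift turns the threshold, between 1 and \<open>n\<close>, into a value of a
    loop counter, which runs from 0 to \<open>n - 1\<close>.\<close>
  moreover have "Suc (k - 1) = k" "k - 1 < n" using k by auto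
  ultimately show ?thesis using ind unfolding I_def by (intro exI[of _ "k - 1"]) simp
qed

section \<open>The algorithm\<close>

text \<open>
  Use of the arrays, beyond 0 (\<open>n\<close>), 1 (adjacency matrix) and 2 (the best independent set found):
  3 row offsets \<open>u * n\<close>; 4, 5, 6 the current bipartite vertex set, its colouring (colour 1 against
  the rest) and its size; 7, 8 a modification of that set and its colouring; 9, 10, 11 results of
  \<open>argmin\<close>; 12 a flag; 13 a counter; 14 the guessed part of the independent set; 15 the current
  bipartite set without the neighbours of the guess; 16, 17 the auction; 18 a candidate; 19 the size
  of array 2; 20 to 26 loop counters and an accumulator; from 30 on the entries of a tuple of
  vertices.
\<close>

abbreviation true_exp :: bexp where
  "true_exp \<equiv> Less (Const 0) (Const 1)"

abbreviation nonzero :: "aexp \<Rightarrow> bexp" where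
  "nonzero e \<equiv> Less (Const 0) e"

abbreviation is_one :: "aexp \<Rightarrow> bexp" where
  "is_one e \<equiv> Conj (nonzero e) (Less e (Const 2))"

abbreviation Disj :: "bexp \<Rightarrow> bexp \<Rightarrow> bexp" where
  "Disj b c \<equiv> Neg (Conj (Neg b) (Neg c))"

text \<open>The row offsets come from array 3 because multiplication is not a primitive operation.
  The two vertices are always the loop counters 20 and 21.\<close>

abbreviation adj :: aexp where
  "adj \<equiv> At 1 (Plus (At 3 (Var 20)) (Var 21))"

definition rows :: prog where
  "rows = PFor 20 (PSeq (PStore 3 (Var 20) (Var 26)) (PStore 26 (Const 0) (Plus (Var 26) (Var 0))))"

text \<open>Truncated subtraction from 1 flips membership for any nonzero mark. Reading from array
  4, and not from its copy in array 7, makes a repeated entry flip only once.\<close>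

definition toggle_tuple :: "nat \<Rightarrow> prog" where
  "toggle_tuple k = PSeq (cmap 20 true_exp 7 (At 4 (Var 20)))
     (store_tuple k 7 (\<lambda>v. Minus (Const 1) (At 4 v)))"

text \<open>
  The cost of a pair \<open>(u, v)\<close> is 0 if \<open>u\<close> is a coloured neighbour of \<open>v\<close>, and 1 otherwise:
  \<open>c - (c - 1)\<close> is 1 for nonzero \<open>c\<close>.
\<close>

definition color_pick :: prog where
  "color_pick = argmin 20 21
     (Conj (nonzero (At 7 (Var 21))) (Less (At 8 (Var 21)) (Const 1)))
     (Minus (Const 1) (Minus (Plus adj
        (Minus (At 8 (Var 20)) (Minus (At 8 (Var 20)) (Const 1)))) (Const 1)))
     (Const 2) 9 10 11"

text \<open>Cost 0 forces the opposite colour, and \<open>3 - c\<close> swaps 1 and 2. Cost 1 means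
  that no uncoloured vertex of the set has a coloured neighbour, so a new component starts with
  colour 1. At cost 2, the cap, all vertices of the set are coloured.\<close>

definition color_assign :: prog where
  "color_assign = PSeq
     (PIf (Less (Var 11) (Const 1)) (PStore 8 (Var 10) (Minus (Const 3) (At 8 (Var 9)))))
     (PIf (is_one (Var 11)) (PStore 8 (Var 10) (Const 1)))"

definition color :: prog where
  "color = PSeq (cmap 20 true_exp 8 (Const 0)) (PFor 22 (PSeq color_pick color_assign))"

text \<open>The greedy colouring runs on any set; only this test for an edge inside a colour class
  decides whether the set counts as bipartite.\<close>

definition check_coloring :: prog where
  "check_coloring = any2 20 21
     (Conj (Conj (nonzero (At 7 (Var 20))) (nonzero (At 7 (Var 21))))
       (Conj (nonzero adj)
         (Disj (Conj (is_one (At 8 (Var 20))) (is_one (At 8 (Var 21))))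
           (Conj (Neg (is_one (At 8 (Var 20)))) (Neg (is_one (At 8 (Var 21))))))))
     12"

definition accept_bipartite :: prog where
  "accept_bipartite = PIf (Conj (Less (Var 12) (Const 1)) (Less (Var 6) (Var 13)))
     (PSeq (cmap 20 true_exp 4 (At 7 (Var 20)))
       (PSeq (cmap 20 true_exp 5 (At 8 (Var 20))) (PStore 6 (Const 0) (Var 13))))"

definition improve :: "nat \<Rightarrow> prog" where
  "improve k = PSeq (toggle_tuple k) (PSeq color (PSeq check_coloring
     (PSeq (count_if 20 (nonzero (At 7 (Var 20))) 13) accept_bipartite)))"

lemma written_schemes [simp]:
  "written (cmap i b a e) = {i, a}"
  "written (mark i j b a e c) = {i, j, a}"
  "written (any2 i j b a) = {i, j, a}"
  "written (count_if i b a) = {i, a}"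
  "written (argmin i j b e e0 x y z) = {i, j, x, y, z}"
  by (auto simp: cmap_def mark_def any2_def count_if_def argmin_def)

lemma wf_prog_schemes [simp]:
  "wf_prog (cmap i b a e) \<longleftrightarrow> i \<noteq> 0 \<and> a \<noteq> 0 \<and> i \<noteq> a"
  "wf_prog (mark i j b a e c) \<longleftrightarrow> i \<noteq> 0 \<and> j \<noteq> 0 \<and> a \<noteq> 0 \<and> distinct [i, j, a]"
  "wf_prog (any2 i j b a) \<longleftrightarrow> i \<noteq> 0 \<and> j \<noteq> 0 \<and> a \<noteq> 0 \<and> distinct [i, j, a]"
  "wf_prog (count_if i b a) \<longleftrightarrow> i \<noteq> 0 \<and> a \<noteq> 0 \<and> i \<noteq> a"
  "wf_prog (argmin i j b e e0 x y z) \<longleftrightarrow>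
    0 \<notin> {i, j, x, y, z} \<and> i \<noteq> j \<and> {i, j} \<inter> {x, y, z} = {}"
  by (auto simp: cmap_def mark_def any2_def count_if_def argmin_def)

section \<open>Memories that represent a graph and vertex sets\<close>

definition graph_memory :: "nat \<Rightarrow> nat set set \<Rightarrow> memory \<Rightarrow> bool" where
  "graph_memory n E s \<longleftrightarrow> s 0 0 = n \<and>
     (\<forall>u<n. \<forall>v<n. s 1 (s 3 u + v) = (if {u, v} \<in> E then 1 else 0))"

definition members :: "nat \<Rightarrow> memory \<Rightarrow> nat \<Rightarrow> nat set" where
  "members n s a = {v. v < n \<and> s a v \<noteq> 0}"

lemma finite_members [simp]: "finite (members n s a)"
  by (simp add: members_def)

lemma graph_memory_cong:
  "graph_memory n E s \<Longrightarrow> s' 0 = s 0 \<Longrightarrow> s' 1 = s 1 \<Longrightarrow> s' 3 = s 3 \<Longrightarrow> graph_memory n E s'"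
  by (simp add: graph_memory_def)

lemma graph_memory_sem:
  "graph_memory n E s \<Longrightarrow> written p \<inter> {0, 1, 3} = {} \<Longrightarrow> graph_memory n E (sem n p s)"
  by (rule graph_memory_cong[of n E s]) (auto intro!: sem_frame)

lemma members_toggle_tuple:
  "members n (sem n (toggle_tuple k) s) 7 =
    toggle n (members n s 4) ((\<lambda>j. s (30 + j) 0) ` {..<Suc k})"
proof -
  define s1 where "s1 = sem n (cmap 20 true_exp 7 (At 4 (Var 20))) s"
  have s1_frame: "s1 b = s b" if "b \<notin> {20, 7}" for b
    unfolding s1_def by (rule sem_frame) (use that in simp)
  have s1: "s1 7 v = (if v < n \<and> True then s 4 v else s 7 v)" for v
    unfolding s1_def by (rule sem_cmap) simp_all
  have "sem n (store_tuple k 7 (\<lambda>v. Minus (Const 1) (At 4 v))) s1 7 v =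
      (if \<exists>j<Suc k. s1 (30 + j) 0 = v then 1 - s1 4 v else s1 7 v)" for v
    by (rule sem_store_tuple) simp_all
  then show ?thesis
    unfolding members_def toggle_def toggle_tuple_def sem.simps s1_def[symmetric]
    by (auto simp: s1 s1_frame split: if_splits)
qed

section \<open>Greedy colouring with two colours\<close>

text \<open>Colour 0 means uncoloured. \<open>b\<close> witnesses that \<open>c\<close> extends to a
  proper 2-colouring of \<open>A\<close>; the witness may change from step to step. Vertices outside
  \<open>A\<close> stay at 0 because \<open>color_pick\<close> does not test whether the coloured
  neighbour belongs to \<open>A\<close>.\<close>

definition partial_coloring :: "nat \<Rightarrow> nat set set \<Rightarrow> nat set \<Rightarrow> (nat \<Rightarrow> nat) \<Rightarrow> bool" where
  "partial_coloring n E A c \<longleftrightarrow>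
     (\<exists>b. (\<forall>u\<in>A. \<forall>v\<in>A. {u, v} \<in> E \<longrightarrow> b u \<noteq> b v) \<and> (\<forall>v\<in>A. c v \<noteq> 0 \<longrightarrow> (c v = 1) = b v)) \<and>
     (\<forall>v<n. v \<notin> A \<longrightarrow> c v = 0) \<and> (\<forall>v<n. c v \<le> 2)"

text \<open>At cost 0 the colour of \<open>v\<close> is forced by its neighbour \<open>u\<close>, so
  the old witness still fits. At cost 1 the witness is adjusted on the uncoloured vertices to give
  \<open>v\<close> colour 1. At cost 2 nothing is left to colour, which the truncated
  \<open>- 1\<close> in the count allows for.\<close>

lemma partial_coloring_extend:
  assumes pc: "partial_coloring n E A c" and A: "A \<subseteq> {..<n}"
    and arg: "is_argmin n (\<lambda>u v. v \<in> A \<and> c v = 0)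
      (\<lambda>u v. if {u, v} \<in> E \<and> c u \<noteq> 0 then 0 else 1) 2 u v m"
    and c': "\<And>w. w < n \<Longrightarrow>
      c' w = (if m < 2 \<and> w = v then (if m = 0 then 3 - c u else 1) else c w)"
  shows "partial_coloring n E A c'"
    and "card {w \<in> A. c' w = 0} \<le> card {w \<in> A. c w = 0} - 1"
proof -
  obtain b where b: "\<forall>u\<in>A. \<forall>v\<in>A. {u, v} \<in> E \<longrightarrow> b u \<noteq> b v"
      "\<forall>v\<in>A. c v \<noteq> 0 \<longrightarrow> (c v = 1) = b v"
    using pc unfolding partial_coloring_def by (elim conjE exE)
  have c: "\<And>v. v < n \<Longrightarrow> v \<notin> A \<Longrightarrow> c v = 0" "\<And>v. v < n \<Longrightarrow> c v \<le> 2"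
    using pc unfolding partial_coloring_def by simp_all
  have finA: "finite A" using A finite_subset by blast
  have min: "m \<le> (if {x, w} \<in> E \<and> c x \<noteq> 0 then 0 else 1)"
    if "x < n" "w \<in> A" "c w = 0" for x w
    using arg that A unfolding is_argmin_def by blast
  have "partial_coloring n E A c' \<and> card {w \<in> A. c' w = 0} \<le> card {w \<in> A. c w = 0} - 1"
  proof (cases "m < 2")
    case False
    have "{w \<in> A. c w = 0} = {}"
    proof (rule ccontr)
      assume "{w \<in> A. c w = 0} \<noteq> {}"
      then obtain w where w: "w \<in> A" "c w = 0" by blast
      then have "w < n" using A by blast
      from min[OF this w] show False using False by (simp split: if_splits)
    qed
    moreover have c'c: "c' w = c w" if "w < n" for w using c'[OF that] False by simp
    ultimately have "{w \<in> A. c' w = 0} = {}" using A by auto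
    then have "card {w \<in> A. c' w = 0} = 0" by (simp only: card.empty)
    moreover have "partial_coloring n E A c'"
      unfolding partial_coloring_def
    proof (intro conjI exI[of _ b])
      show "\<forall>v\<in>A. c' v \<noteq> 0 \<longrightarrow> (c' v = 1) = b v"
      proof
        fix w assume "w \<in> A"
        moreover from this have "c' w = c w" using c'c A by blast
        ultimately show "c' w \<noteq> 0 \<longrightarrow> (c' w = 1) = b w" using b(2) by simp
      qed
    qed (use b(1) c c'c in auto)
    ultimately show ?thesis by simp
  next
    case True
    then have uv: "u < n" "v < n" "v \<in> A" "c v = 0"
        and cost: "(if {u, v} \<in> E \<and> c u \<noteq> 0 then 0 else 1) = m"
      using arg unfolding is_argmin_def by simp_all
    have c'v: "c' v = (if m = 0 then 3 - c u else 1)" using c'[OF uv(2)] True by simp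
    have c'w: "c' w = c w" if "w < n" "w \<noteq> v" for w using c'[OF that(1)] that(2) by simp
    have c'A: "c' w = c w" if "w \<in> A" "w \<noteq> v" for w using c'w that A by blast
    have v12: "c' v \<noteq> 0" "c' v \<le> 2" using c'v c(2)[OF uv(1)] cost by (auto split: if_splits)
    have "c' w = 0 \<longleftrightarrow> c w = 0 \<and> w \<noteq> v" if "w \<in> A" for w
      using c'A[OF that] v12(1) by (cases "w = v") auto
    then have "{w \<in> A. c' w = 0} = {w \<in> A. c w = 0} - {v}"
      by auto
    moreover have "v \<in> {w \<in> A. c w = 0}" using uv by simp
    ultimately have card: "card {w \<in> A. c' w = 0} \<le> card {w \<in> A. c w = 0} - 1"
      using finA by (simp add: card_Diff_singleton)
    have "\<exists>b'. (\<forall>u\<in>A. \<forall>v\<in>A. {u, v} \<in> E \<longrightarrow> b' u \<noteq> b' v) \<and> (\<forall>v\<in>A. c' v \<noteq> 0 \<longrightarrow> (c' v = 1) = b' v)"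
    proof (cases "m = 0")
      case m0: True
      then have e: "{u, v} \<in> E" "c u \<noteq> 0" using cost by (auto split: if_splits)
      then have uA: "u \<in> A" using c(1)[OF uv(1)] by auto
      have "(c u = 1) = b u" using b(2) e(2) uA by blast
      moreover have "b u \<noteq> b v" using b(1) e(1) uA uv(3) by blast
      moreover have "c u \<le> 2" by (rule c(2)[OF uv(1)])
      ultimately have cv: "(c' v = 1) = b v" using c'v m0 e(2) by auto
      show ?thesis
      proof (intro exI[of _ b] conjI ballI impI)
        fix w assume w: "w \<in> A" "c' w \<noteq> 0"
        show "(c' w = 1) = b w"
        proof (cases "w = v")
          case False
          then have "c' w = c w" using c'A w by blast
          then show ?thesis using w b by simp
        qed (use cv in simp)
      qed (use b(1) in simp)
    next
      case m1: False
      \<comment> \<open>No edge joins the coloured to the uncoloured vertices, so flipping the latter is harmless.\<close>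
      define b' where "b' = (\<lambda>x. if c x = 0 then b x = b v else b x)"
      have no_edge: False if "x \<in> A" "y \<in> A" "{x, y} \<in> E" "c x \<noteq> 0" "c y = 0" for x y
      proof -
        have "x < n" using that A by auto
        from min[OF this that(2,5)] show False using that m1 by simp
      qed
      show ?thesis
      proof (intro exI[of _ b'] conjI ballI impI)
        fix x y assume xy: "x \<in> A" "y \<in> A" "{x, y} \<in> E"
        have yx: "{y, x} \<in> E" using xy(3) by (simp add: insert_commute)
        have "b x \<noteq> b y" using b(1) xy by simp
        moreover have "(c x = 0) = (c y = 0)"
          using no_edge[OF xy] no_edge[OF xy(2,1) yx] by blast
        ultimately show "b' x \<noteq> b' y" unfolding b'_def by auto
      next
        fix w assume w: "w \<in> A" "c' w \<noteq> 0"
        show "(c' w = 1) = b' w"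
        proof (cases "w = v")
          case True
          then show ?thesis using c'v m1 uv(4) unfolding b'_def by simp
        next
          case False
          then have "c' w = c w" using c'A w by blast
          then show ?thesis using w b unfolding b'_def by simp
        qed
      qed
    qed
    moreover have "\<forall>w<n. w \<notin> A \<longrightarrow> c' w = 0"
    proof (intro allI impI)
      fix w assume "w < n" "w \<notin> A"
      then show "c' w = 0" using c'w[of w] c(1)[of w] uv(3) by auto
    qed
    moreover have "\<forall>w<n. c' w \<le> 2"
    proof (intro allI impI)
      fix w assume "w < n"
      then show "c' w \<le> 2" using c'w[of w] c(2)[of w] v12 by (cases "w = v") auto
    qed
    ultimately show ?thesis using card unfolding partial_coloring_def by blast
  qed
  then show "partial_coloring n E A c'"
    and "card {w \<in> A. c' w = 0} \<le> card {w \<in> A. c w = 0} - 1" by simp_all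
qed

lemma sem_color_step:
  assumes gm: "graph_memory n E s" and pc: "partial_coloring n E (members n s 7) (s 8)"
    and t: "t = sem n (PSeq color_pick color_assign) s"
  shows "partial_coloring n E (members n s 7) (t 8)"
    and "card {w \<in> members n s 7. t 8 w = 0} \<le> card {w \<in> members n s 7. s 8 w = 0} - 1"
proof -
  define A where "A = members n s 7"
  define s1 where "s1 = sem n color_pick s"
  have frame: "s1 b = s b" if "b \<notin> {20, 21, 9, 10, 11}" for b
    unfolding s1_def by (rule sem_frame) (use that in \<open>simp add: color_pick_def\<close>)
  have le2: "s 8 u \<le> 2" if "u < n" for u
    using pc that unfolding partial_coloring_def by simp
  have arg: "is_argmin n (\<lambda>u v. v \<in> A \<and> s 8 v = 0)
      (\<lambda>u v. if {u, v} \<in> E \<and> s 8 u \<noteq> 0 then 0 else 1) 2 (s1 9 0) (s1 10 0) (s1 11 0)"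
    unfolding s1_def color_pick_def
  proof (rule sem_argmin, goal_cases)
    case (2 s')
    let ?u = "s' 20 0" and ?v = "s' 21 0"
    have "s' 1 (s' 3 ?u + ?v) = (if {?u, ?v} \<in> E then 1 else 0)"
      using gm 2 unfolding graph_memory_def by simp
    moreover have "s' 7 = s 7" "s' 8 = s 8" using 2 by simp_all
    ultimately show ?case using 2 unfolding A_def members_def by auto
  qed simp_all
  have t_eq: "t = sem n color_assign s1" by (simp add: t s1_def)
  have "t 8 w = (if s1 11 0 < 2 \<and> w = s1 10 0
      then (if s1 11 0 = 0 then 3 - s 8 (s1 9 0) else 1) else s 8 w)" for w
    unfolding t_eq color_assign_def by (auto simp: frame)
  from partial_coloring_extend[OF pc[folded A_def] _ arg this]
  show "partial_coloring n E (members n s 7) (t 8)"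
    and "card {w \<in> members n s 7. t 8 w = 0} \<le> card {w \<in> members n s 7. s 8 w = 0} - 1"
    unfolding A_def members_def by auto
qed

text \<open>Every round colours a vertex as long as one is left, so \<open>n\<close> rounds suffice;
  then the witness in \<open>partial_coloring\<close> coincides on the whole set with the computed
  colouring.\<close>

lemma sem_color:
  assumes gm: "graph_memory n E s" and bip: "bipartite_on E (members n s 7)"
    and uv: "u \<in> members n s 7" "v \<in> members n s 7" "{u, v} \<in> E"
  shows "(sem n color s 8 u = 1) \<noteq> (sem n color s 8 v = 1)"
proof -
  define A where "A = members n s 7"
  define s1 where "s1 = sem n (cmap 20 true_exp 8 (Const 0)) s"
  have s1: "s1 8 w = (if w < n \<and> True then 0 else s 8 w)" for w
    unfolding s1_def by (rule sem_cmap) simp_all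
  have frame: "s1 b = s b" if "b \<notin> {20, 8}" for b
    unfolding s1_def by (rule sem_frame) (use that in simp)
  let ?Q = "\<lambda>t. partial_coloring n E A (t 8) \<and> card {w \<in> A. t 8 w = 0} \<le> 0"
  have "?Q (sem n (PFor 22 (PSeq color_pick color_assign)) s1)"
  proof (rule sem_PFor_rule[where Q = ?Q and P = "\<lambda>r t. graph_memory n E t \<and> t 7 = s 7 \<and>
      partial_coloring n E A (t 8) \<and> card {w \<in> A. t 8 w = 0} \<le> n - r"], goal_cases)
    case 1
    obtain c where "\<forall>u\<in>A. \<forall>v\<in>A. {u, v} \<in> E \<longrightarrow> c u \<noteq> (c v :: bool)"
      using bip unfolding bipartite_on_def A_def by (elim exE)
    moreover have "s1 8 w = 0" if "w \<in> A" for w using that s1 unfolding A_def members_def by simp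
    ultimately have "partial_coloring n E A (s1 8)"
      unfolding partial_coloring_def by (intro conjI exI[of _ c]) (auto simp: s1)
    moreover have "card {w \<in> A. s1 8 w = 0} \<le> card {..<n}"
      by (rule card_mono) (auto simp: A_def members_def)
    moreover have "graph_memory n E s1" by (rule graph_memory_cong[OF gm]) (simp_all add: frame)
    ultimately show ?case by (simp add: frame)
  next
    case (2 r t)
    let ?s = "put 22 r t" and ?t = "sem n (PSeq color_pick color_assign) (put 22 r t)"
    have gm': "graph_memory n E ?s" using 2 by (auto intro: graph_memory_cong)
    have A_eq: "members n ?s 7 = A" using 2 unfolding A_def members_def by simp
    have c8: "?s 8 = t 8" by simp
    have "partial_coloring n E (members n ?s 7) (?s 8)" unfolding A_eq c8 using 2 by blast
    note step = sem_color_step[OF gm' this refl, unfolded A_eq c8]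
    moreover have "graph_memory n E ?t"
      by (rule graph_memory_sem[OF gm']) (simp add: color_pick_def color_assign_def)
    moreover have "?t 7 = ?s 7"
      by (rule sem_frame) (simp add: color_pick_def color_assign_def)
    ultimately show ?case using 2 by auto
  next
    case (3 t)
    then show ?case by simp
  qed
  then have pc: "partial_coloring n E A (sem n color s 8)"
      and card0: "card {w \<in> A. sem n color s 8 w = 0} \<le> 0"
    by (simp_all only: color_def sem.simps(2) s1_def)
  have "{w \<in> A. sem n color s 8 w = 0} = {}" using card0 by (simp add: A_def)
  then have "sem n color s 8 u \<noteq> 0" "sem n color s 8 v \<noteq> 0" using uv unfolding A_def by auto
  moreover obtain b where "\<forall>u\<in>A. \<forall>v\<in>A. {u, v} \<in> E \<longrightarrow> b u \<noteq> (b v :: bool)"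
      "\<forall>v\<in>A. sem n color s 8 v \<noteq> 0 \<longrightarrow> (sem n color s 8 v = 1) = b v"
    using pc unfolding partial_coloring_def by (elim conjE exE)
  ultimately show ?thesis using uv unfolding A_def by simp
qed

section \<open>One exchange of the local search\<close>

definition colored_bipartite :: "nat \<Rightarrow> nat set set \<Rightarrow> memory \<Rightarrow> bool" where
  "colored_bipartite n E s \<longleftrightarrow>
     (\<forall>u\<in>members n s 4. \<forall>v\<in>members n s 4. {u, v} \<in> E \<longrightarrow> (s 5 u = 1) \<noteq> (s 5 v = 1)) \<and>
     s 6 0 = card (members n s 4)"

lemma colored_bipartite_cong:
  "colored_bipartite n E s \<Longrightarrow> s' 4 = s 4 \<Longrightarrow> s' 5 = s 5 \<Longrightarrow> s' 6 = s 6 \<Longrightarrow> colored_bipartite n E s'"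
  by (simp add: colored_bipartite_def members_def)

lemma bipartite_on_colored: "colored_bipartite n E s \<Longrightarrow> bipartite_on E (members n s 4)"
  unfolding colored_bipartite_def bipartite_on_def by (intro exI[of _ "\<lambda>u. s 5 u = 1"]) simp

lemma written_improve: "written (improve k) \<subseteq> {4..13} \<union> {20..22}"
  by (auto simp: improve_def toggle_tuple_def color_def color_pick_def color_assign_def
      check_coloring_def accept_bipartite_def written_store_tuple)

lemma wf_prog_improve: "wf_prog (improve k)"
  by (simp add: improve_def toggle_tuple_def color_def color_pick_def color_assign_def
      check_coloring_def accept_bipartite_def wf_prog_store_tuple)

text \<open>The current set is replaced only by a strictly larger one whose colouring has been
  checked. For a bipartite \<open>A'\<close> the check succeeds by \<open>sem_color\<close>, so a
  profitable exchange is never missed.\<close>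

lemma sem_improve:
  assumes gm: "graph_memory n E s" and cb: "colored_bipartite n E s"
    and t: "t = sem n (improve k) s"
    and A': "A' = toggle n (members n s 4) ((\<lambda>j. s (30 + j) 0) ` {..<Suc k})"
  shows "colored_bipartite n E t"
    and "members n t 4 = members n s 4 \<or> members n t 4 = A' \<and> card (members n s 4) < card A'"
    and "bipartite_on E A' \<Longrightarrow> card A' \<le> card (members n t 4)"
proof -
  define s1 where "s1 = sem n (toggle_tuple k) s"
  define s2 where "s2 = sem n color s1"
  define s3 where "s3 = sem n check_coloring s2"
  define s4 where "s4 = sem n (count_if 20 (nonzero (At 7 (Var 20))) 13) s3"
  have t_eq: "t = sem n accept_bipartite s4"
    unfolding t s4_def s3_def s2_def s1_def improve_def by simp
  have A'1: "members n s1 7 = A'" unfolding s1_def A' by (rule members_toggle_tuple)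
  have f1: "s1 b = s b" if "b \<notin> {20, 7}" for b
    unfolding s1_def
    by (rule sem_frame) (use that in \<open>simp add: toggle_tuple_def written_store_tuple\<close>)
  have f2: "s2 b = s1 b" if "b \<notin> {8, 9, 10, 11, 20, 21, 22}" for b
    unfolding s2_def
    by (rule sem_frame) (use that in \<open>simp add: color_def color_pick_def color_assign_def\<close>)
  have f3: "s3 b = s2 b" if "b \<notin> {12, 20, 21}" for b
    unfolding s3_def by (rule sem_frame) (use that in \<open>simp add: check_coloring_def\<close>)
  have f4: "s4 b = s3 b" if "b \<notin> {13, 20}" for b
    unfolding s4_def by (rule sem_frame) (use that in simp)
  have gm1: "graph_memory n E s1" by (rule graph_memory_cong[OF gm]) (simp_all add: f1)
  have gm2: "graph_memory n E s2" by (rule graph_memory_cong[OF gm1]) (simp_all add: f2)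
  have A'7: "v \<in> A' \<longleftrightarrow> v < n \<and> s2 7 v \<noteq> 0" for v
    using A'1 f2[of 7] unfolding members_def by auto
  have flag: "s3 12 0 = (if \<exists>u<n. \<exists>v<n. u \<in> A' \<and> v \<in> A' \<and> {u, v} \<in> E \<and>
      (s2 8 u = 1) = (s2 8 v = 1) then 1 else 0)"
    unfolding s3_def check_coloring_def
  proof (rule sem_any2, goal_cases)
    case (4 s')
    let ?u = "s' 20 0" and ?v = "s' 21 0"
    have "s' 1 (s' 3 ?u + ?v) = (if {?u, ?v} \<in> E then 1 else 0)"
      using gm2 4 unfolding graph_memory_def by simp
    moreover have "s' 7 = s2 7" "s' 8 = s2 8" using 4 by simp_all
    moreover have "(0 < x \<and> x < 2) \<longleftrightarrow> x = 1" for x :: nat by auto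
    ultimately show ?case using 4(2,3) by (auto simp: A'7)
  qed simp_all
  have "s4 13 0 = card {v. v < n \<and> s3 7 v \<noteq> 0}"
    unfolding s4_def by (rule sem_count_if) simp_all
  also have "{v. v < n \<and> s3 7 v \<noteq> 0} = A'" using A'7 f3[of 7] by auto
  finally have cnt: "s4 13 0 = card A'" .
  have s4s: "s4 4 = s 4" "s4 5 = s 5" "s4 6 = s 6" by (simp_all add: f4 f3 f2 f1)
  have s42: "s4 7 = s2 7" "s4 8 = s2 8" "s4 12 = s3 12" by (simp_all add: f4 f3)
  define good where "good \<longleftrightarrow> s3 12 0 = 0 \<and> card (members n s 4) < card A'"
  have s60: "s 6 0 = card (members n s 4)" using cb unfolding colored_bipartite_def by blast
  show "bipartite_on E A' \<Longrightarrow> card A' \<le> card (members n t 4)"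
    and "colored_bipartite n E t"
    and "members n t 4 = members n s 4 \<or> members n t 4 = A' \<and> card (members n s 4) < card A'"
  proof -
    have "bipartite_on E A' \<Longrightarrow> s3 12 0 = 0"
    proof -
      assume "bipartite_on E A'"
      then have "(s2 8 u = 1) \<noteq> (s2 8 v = 1)" if "u \<in> A'" "v \<in> A'" "{u, v} \<in> E" for u v
        unfolding s2_def using sem_color[OF gm1, of u v] that A'1 by simp
      then show "s3 12 0 = 0" unfolding flag by auto
    qed
    note complete = this
    have "(bipartite_on E A' \<longrightarrow> card A' \<le> card (members n t 4)) \<and> colored_bipartite n E t \<and>
      (members n t 4 = members n s 4 \<or> members n t 4 = A' \<and> card (members n s 4) < card A')"
    proof (cases good)
      case False
      then have "t = s4" unfolding t_eq accept_bipartite_def good_def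
        by (auto simp: cnt s42 s4s s60)
      then have "members n t 4 = members n s 4" "colored_bipartite n E t"
        using colored_bipartite_cong[OF cb] s4s by (simp_all add: members_def)
      then show ?thesis using False complete unfolding good_def by auto
    next
      case True
      define s5 where "s5 = sem n (cmap 20 true_exp 4 (At 7 (Var 20))) s4"
      define s6 where "s6 = sem n (cmap 20 true_exp 5 (At 8 (Var 20))) s5"
      have t6: "t = put 6 (s6 13 0) s6"
        using True unfolding t_eq accept_bipartite_def good_def s5_def s6_def
        by (simp add: cnt s42 s4s s60)
      have f5: "s5 b = s4 b" if "b \<notin> {4, 20}" for b
        unfolding s5_def by (rule sem_frame) (use that in simp)
      have f6: "s6 b = s5 b" if "b \<notin> {5, 20}" for b
        unfolding s6_def by (rule sem_frame) (use that in simp)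
      have "s5 4 v = (if v < n \<and> True then s4 7 v else s4 4 v)" for v
        unfolding s5_def by (rule sem_cmap) simp_all
      then have "members n s5 4 = A'" unfolding members_def using A'7 s42 by auto
      then have m: "members n t 4 = A'" using t6 f6[of 4] unfolding members_def by simp
      have "s6 5 v = (if v < n \<and> True then s5 8 v else s5 5 v)" for v
        unfolding s6_def by (rule sem_cmap) simp_all
      then have c: "t 5 v = s2 8 v" if "v < n" for v
        using that t6 f5[of 8] s42 by simp
      have "(t 5 u = 1) \<noteq> (t 5 v = 1)" if "u \<in> A'" "v \<in> A'" "{u, v} \<in> E" for u v
      proof -
        have "u < n" "v < n" using that A'7 by auto
        then show ?thesis using True that unfolding good_def flag by (auto simp: c split: if_splits)
      qed
      moreover have "t 6 0 = card A'" using t6 f6[of 13] f5[of 13] cnt by simp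
      ultimately have "colored_bipartite n E t" unfolding colored_bipartite_def m by blast
      then show ?thesis using m True unfolding good_def by simp
    qed
    then show "bipartite_on E A' \<Longrightarrow> card A' \<le> card (members n t 4)"
      and "colored_bipartite n E t"
      and "members n t 4 = members n s 4 \<or> members n t 4 = A' \<and> card (members n s 4) < card A'" by auto
  qed
qed

section \<open>Programs for guesses, auction and candidates\<close>

definition guess_tuple :: "nat \<Rightarrow> prog" where
  "guess_tuple k = PSeq (cmap 20 true_exp 14 (Const 0)) (store_tuple k 14 (\<lambda>_. Const 1))"

definition remove_neighbours :: prog where
  "remove_neighbours = PSeq (cmap 20 true_exp 15 (At 4 (Var 20)))
     (mark 20 21 (Conj (nonzero (At 14 (Var 20))) (nonzero adj)) 15 (Var 21) 0)"

text \<open>The cap \<open>Var 0\<close> is \<open>n\<close>: prices from \<open>n\<close> on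
  attract no bid.\<close>

definition bid_pick :: prog where
  "bid_pick = argmin 20 21
     (Conj (Conj (nonzero (At 15 (Var 20))) (is_one (At 5 (Var 20))))
       (Conj (Conj (nonzero (At 15 (Var 21))) (Neg (is_one (At 5 (Var 21)))))
         (Conj (nonzero adj) (Less (At 16 (Var 20)) (Const 1)))))
     (At 17 (Var 21)) (Var 0) 9 10 11"

text \<open>With the item \<open>r\<close> in array 10, the two comparisons \<open>r < x\<close> and
  \<open>x < r + 2\<close> express \<open>x = Suc r\<close>; the first assignment thus evicts the
  holder of \<open>r\<close> before the bidder in array 9 takes it.\<close>

definition bid :: prog where
  "bid = PIf (Less (Var 11) (Var 0))
     (PSeq (cmap 20 (Conj (Less (Var 10) (At 16 (Var 20))) (Less (At 16 (Var 20)) (Plus (Var 10) (Const 2))))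
         16 (Const 0))
       (PSeq (PStore 16 (Var 9) (Plus (Var 10) (Const 1)))
         (PStore 17 (Var 10) (Plus (At 17 (Var 10)) (Const 1)))))"

text \<open>Each bid raises the sum of the prices by 1, and the sum never exceeds
  \<open>n * n\<close>; hence two nested loops are enough.\<close>

definition auction :: prog where
  "auction = PSeq (cmap 20 true_exp 16 (Const 0)) (PSeq (cmap 20 true_exp 17 (Const 0))
     (PFor 22 (PFor 23 (PSeq bid_pick bid))))"

definition candidate :: prog where
  "candidate = PSeq (cmap 20 true_exp 18 (At 14 (Var 20)))
     (cmap 20 (Conj (nonzero (At 15 (Var 20)))
        (Disj
          (Conj (is_one (At 5 (Var 20)))
            (Disj (Less (At 16 (Var 20)) (Const 1))
              (Less (Plus (Var 24) (Const 1)) (At 17 (Minus (At 16 (Var 20)) (Const 1))))))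
          (Conj (Neg (is_one (At 5 (Var 20)))) (Less (At 17 (Var 20)) (Plus (Var 24) (Const 1))))))
      18 (Const 1))"

definition check_independent :: prog where
  "check_independent = any2 20 21
     (Conj (Conj (nonzero (At 18 (Var 20))) (nonzero (At 18 (Var 21)))) (nonzero adj)) 12"

definition accept_independent :: prog where
  "accept_independent = PIf (Conj (Less (Var 12) (Const 1)) (Less (Var 19) (Var 13)))
     (PSeq (cmap 20 true_exp 2 (At 18 (Var 20))) (PStore 19 (Const 0) (Var 13)))"

definition try_candidate :: prog where
  "try_candidate = PSeq candidate (PSeq check_independent
     (PSeq (count_if 20 (nonzero (At 18 (Var 20))) 13) accept_independent))"

definition search :: "nat \<Rightarrow> prog" where
  "search k = PSeq (guess_tuple k) (PSeq remove_neighbours (PSeq auction (PFor 24 try_candidate)))"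

text \<open>\<open>improve\<close> and \<open>search\<close> take the index of the last tuple entry,
  hence \<open>4 * l\<close> beside \<open>4 * l + 1\<close> loops. The tuple length of the
  exchanges is reused for the guesses, where at most \<open>3 * l\<close> vertices have to be
  covered.\<close>

definition max_independent_prog :: "nat \<Rightarrow> prog" where
  "max_independent_prog l = PSeq rows
     (PSeq (PFor 25 (nest (4 * l + 1) (improve (4 * l)))) (nest (4 * l + 1) (search (4 * l))))"

lemma is_one_iff: "0 < x \<and> x < 2 \<longleftrightarrow> x = (1 :: nat)"
  by auto

section \<open>Guessed vertices and the remaining bipartite graph\<close>

lemma sem_guess_tuple:
  "members n (sem n (guess_tuple k) s) 14 = (\<lambda>j. s (30 + j) 0) ` {..<Suc k} \<inter> {..<n}"
proof -
  define s1 where "s1 = sem n (cmap 20 true_exp 14 (Const 0)) s"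
  have s1_frame: "s1 b = s b" if "b \<notin> {20, 14}" for b
    unfolding s1_def by (rule sem_frame) (use that in simp)
  have s1: "s1 14 v = (if v < n \<and> True then 0 else s 14 v)" for v
    unfolding s1_def by (rule sem_cmap) simp_all
  have "sem n (store_tuple k 14 (\<lambda>_. Const 1)) s1 14 v =
      (if \<exists>j<Suc k. s1 (30 + j) 0 = v then 1 else s1 14 v)" for v
    by (rule sem_store_tuple) simp_all
  then show ?thesis
    unfolding members_def guess_tuple_def sem.simps s1_def[symmetric]
    by (auto simp: s1 s1_frame split: if_splits)
qed

lemma sem_remove_neighbours:
  assumes gm: "graph_memory n E s"
  shows "members n (sem n remove_neighbours s) 15 =
    {v \<in> members n s 4. \<forall>u\<in>members n s 14. {u, v} \<notin> E}"
proof -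
  define s1 where "s1 = sem n (cmap 20 true_exp 15 (At 4 (Var 20))) s"
  have frame: "s1 b = s b" if "b \<notin> {20, 15}" for b
    unfolding s1_def by (rule sem_frame) (use that in simp)
  have gm1: "graph_memory n E s1" by (rule graph_memory_cong[OF gm]) (simp_all add: frame)
  have s1: "s1 15 v = (if v < n \<and> True then s 4 v else s 15 v)" for v
    unfolding s1_def by (rule sem_cmap) simp_all
  have "sem n remove_neighbours s 15 v =
      (if \<exists>u<n. \<exists>w<n. (s1 14 u \<noteq> 0 \<and> {u, w} \<in> E) \<and> w = v then 0 else s1 15 v)" for v
    unfolding remove_neighbours_def sem.simps s1_def[symmetric]
  proof (rule sem_mark, goal_cases)
    case (4 s')
    let ?u = "s' 20 0" and ?v = "s' 21 0"
    have "s' 1 (s' 3 ?u + ?v) = (if {?u, ?v} \<in> E then 1 else 0)"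
      using gm1 4 unfolding graph_memory_def by simp
    moreover have "s' 14 = s1 14" using 4 by simp
    ultimately show ?case by auto
  qed simp_all
  then show ?thesis unfolding members_def by (auto simp: s1 frame)
qed

section \<open>Correctness of the auction program\<close>

definition bidders :: "nat \<Rightarrow> memory \<Rightarrow> nat set" where
  "bidders n s = {v \<in> members n s 15. s 5 v = 1}"

definition items :: "nat \<Rightarrow> memory \<Rightarrow> nat set" where
  "items n s = {v \<in> members n s 15. s 5 v \<noteq> 1}"

text \<open>The sum of the prices is the potential that bounds the number of bids. If no unmatched
  bidder sees a price below \<open>n\<close>, the capped minimum is \<open>n\<close> and arrays 16
  and 17 are left alone.\<close>

lemma sem_bid:
  assumes gm: "graph_memory n E s" and L: "L = bidders n s" and R: "R = items n s"
    and inv: "auction_inv n E L R (s 16) (s 17)" and t: "t = sem n (PSeq bid_pick bid) s"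
  shows "auction_inv n E L R (t 16) (t 17) \<and>
    (if auction_done n E L R (s 16) (s 17) then t 16 = s 16 \<and> t 17 = s 17
     else sum (t 17) {..<n} = Suc (sum (s 17) {..<n}))"
proof -
  define s1 where "s1 = sem n bid_pick s"
  define u r m where "u = s1 9 0" and "r = s1 10 0" and "m = s1 11 0"
  have frame: "s1 b = s b" if "b \<notin> {20, 21, 9, 10, 11}" for b
    unfolding s1_def by (rule sem_frame) (use that in \<open>simp add: bid_pick_def\<close>)
  have n: "s 0 0 = n" using gm unfolding graph_memory_def by simp
  have LR: "L \<subseteq> {..<n}" "R \<subseteq> {..<n}"
    unfolding L R bidders_def items_def members_def by auto
  have arg: "is_argmin n (\<lambda>u v. u \<in> L \<and> v \<in> R \<and> {u, v} \<in> E \<and> s 16 u = 0) (\<lambda>u v. s 17 v) n u r m"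
    unfolding u_def r_def m_def s1_def bid_pick_def
  proof (rule sem_argmin, goal_cases)
    case (2 s')
    let ?u = "s' 20 0" and ?v = "s' 21 0"
    have "s' 1 (s' 3 ?u + ?v) = (if {?u, ?v} \<in> E then 1 else 0)"
      using gm 2 unfolding graph_memory_def by simp
    moreover have "s' 15 = s 15" "s' 5 = s 5" "s' 16 = s 16" "s' 17 = s 17" using 2 by simp_all
    moreover have "?u \<in> L \<longleftrightarrow> s 15 ?u \<noteq> 0 \<and> s 5 ?u = 1" "?v \<in> R \<longleftrightarrow> s 15 ?v \<noteq> 0 \<and> s 5 ?v \<noteq> 1"
      using 2 unfolding L R bidders_def items_def members_def by auto
    ultimately show ?case by (simp add: is_one_iff)
  qed (simp_all add: n)
  have t_eq: "t = sem n bid s1" by (simp add: t s1_def)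
  have m0: "s1 0 0 = n" "s1 11 0 = m" "s1 10 0 = r" "s1 9 0 = u"
    using n frame[of 0] by (simp_all add: m_def r_def u_def)
  show ?thesis
  proof (cases "m < n")
    case False
    have "n \<le> s 17 v" if "x \<in> L" "v \<in> R" "s 16 x = 0" "{x, v} \<in> E" for x v
    proof -
      have "x < n" "v < n" using that LR by auto
      then have "m \<le> s 17 v" using arg that unfolding is_argmin_def by blast
      then show ?thesis using False by simp
    qed
    then have "auction_done n E L R (s 16) (s 17)" unfolding auction_done_def by simp
    moreover have "t = s1" unfolding t_eq bid_def using False m0 by simp
    then have "t 16 = s 16" "t 17 = s 17" by (simp_all add: frame)
    ultimately show ?thesis using inv by simp
  next
    case True
    then have ur: "u < n" "r < n" "u \<in> L" "r \<in> R" "{u, r} \<in> E" "s 16 u = 0" "s 17 r = m"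
      using arg unfolding is_argmin_def by simp_all
    have cheapest: "s 17 r \<le> s 17 q" if "q \<in> R" "{u, q} \<in> E" for q
    proof -
      have "q < n" using that LR by auto
      then have "m \<le> s 17 q" using arg ur(1,3,6) that unfolding is_argmin_def by blast
      then show ?thesis using ur by simp
    qed
    define s2 where "s2 = sem n (cmap 20 (Conj (Less (Var 10) (At 16 (Var 20)))
      (Less (At 16 (Var 20)) (Plus (Var 10) (Const 2)))) 16 (Const 0)) s1"
    have f2: "s2 b = s1 b" if "b \<notin> {20, 16}" for b
      unfolding s2_def by (rule sem_frame) (use that in simp)
    have s2: "s2 16 v = (if v < n \<and> s1 16 v = Suc r then 0 else s1 16 v)" for v
      unfolding s2_def
    proof (rule sem_cmap, goal_cases)
      case (2 s')
      then have "s' 10 = s1 10" by simp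
      then show ?case using 2(3) m0 by auto
    qed simp
    have t': "t = (let s3 = s2(16 := (s2 16)(u := Suc r)) in s3(17 := (s3 17)(r := Suc (s3 17 r))))"
      unfolding t_eq bid_def using True m0 f2[of 10] f2[of 9] by (simp add: s2_def[symmetric] Let_def)
    have t16: "t 16 v = (if v = u then Suc r else if s 16 v = Suc r then 0 else s 16 v)"
      if "v < n" for v
      using that unfolding t' Let_def by (simp add: s2 frame)
    have t17: "t 17 q = (if q = r then s 17 r + 1 else s 17 q)" for q
      unfolding t' Let_def by (simp add: f2 frame)
    have "auction_inv n E L R (t 16) (t 17)"
      by (rule auction_bid[OF inv LR ur(3,6,4,5) _ cheapest t16 t17])
        (use ur True in simp_all)
    moreover have "\<not> auction_done n E L R (s 16) (s 17)"
      using ur True unfolding auction_done_def by force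
    moreover have "sum (t 17) {..<n} = Suc (sum (s 17) {..<n})"
    proof -
      have "sum (t 17) {..<n} = t 17 r + sum (t 17) ({..<n} - {r})"
        using ur by (intro sum.remove) auto
      also have "sum (t 17) ({..<n} - {r}) = sum (s 17) ({..<n} - {r})"
        by (rule sum.cong) (auto simp: t17)
      also have "t 17 r + sum (s 17) ({..<n} - {r}) = Suc (s 17 r + sum (s 17) ({..<n} - {r}))"
        by (simp add: t17)
      also have "s 17 r + sum (s 17) ({..<n} - {r}) = sum (s 17) {..<n}"
        using ur by (intro sum.remove[symmetric]) auto
      finally show ?thesis .
    qed
    ultimately show ?thesis by simp
  qed
qed

lemma written_bid: "written (PSeq bid_pick bid) = {9, 10, 11, 16, 17, 20, 21}"
  by (auto simp: bid_pick_def bid_def)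

lemma sem_auction:
  assumes gm: "graph_memory n E s" and L: "L = bidders n s" and R: "R = items n s"
    and t: "t = sem n auction s"
  shows "auction_inv n E L R (t 16) (t 17)" and "auction_done n E L R (t 16) (t 17)"
proof -
  define s1 where "s1 = sem n (cmap 20 true_exp 16 (Const 0)) s"
  define s2 where "s2 = sem n (cmap 20 true_exp 17 (Const 0)) s1"
  have f1: "s1 b = s b" if "b \<notin> {20, 16}" for b
    unfolding s1_def by (rule sem_frame) (use that in simp)
  have f2: "s2 b = s1 b" if "b \<notin> {20, 17}" for b
    unfolding s2_def by (rule sem_frame) (use that in simp)
  have s1: "s1 16 v = (if v < n \<and> True then 0 else s 16 v)" for v
    unfolding s1_def by (rule sem_cmap) simp_all
  have s2: "s2 17 v = (if v < n \<and> True then 0 else s1 17 v)" for v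
    unfolding s2_def by (rule sem_cmap) simp_all
  have LR: "L \<subseteq> {..<n}" "R \<subseteq> {..<n}"
    unfolding L R bidders_def items_def members_def by auto
  \<comment> \<open>\<open>k\<close> counts the attempts to bid: until the auction is done, each of
    them has raised the sum of the prices.\<close>
  define I where "I = (\<lambda>k t. graph_memory n E t \<and> t 15 = s 15 \<and> t 5 = s 5 \<and>
    auction_inv n E L R (t 16) (t 17) \<and>
    (auction_done n E L R (t 16) (t 17) \<or> k \<le> sum (t 17) {..<n}))"
  have I_put: "I k (put i x t)" if "I k t" "i \<in> {22, 23}" for k i x t
    using that graph_memory_cong[of n E t "put i x t"] unfolding I_def by auto
  have step: "I (Suc k) (sem n (PSeq bid_pick bid) t)" if "I k t" for k t
  proof -
    let ?t = "sem n (PSeq bid_pick bid) t"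
    have It: "graph_memory n E t" "t 15 = s 15" "t 5 = s 5" "auction_inv n E L R (t 16) (t 17)"
        "auction_done n E L R (t 16) (t 17) \<or> k \<le> sum (t 17) {..<n}"
      using that unfolding I_def by blast+
    have "L = bidders n t" "R = items n t"
      unfolding L R bidders_def items_def members_def using It by simp_all
    note * = sem_bid[OF It(1) this It(4) refl]
    moreover have "?t 15 = s 15" "?t 5 = s 5"
      using It(2,3) sem_frame[of _ "PSeq bid_pick bid" n t] by (simp_all only: written_bid) simp_all
    moreover have "graph_memory n E ?t"
      by (rule graph_memory_sem[OF It(1)], unfold written_bid) simp
    ultimately show ?thesis using It(5) unfolding I_def by (auto split: if_splits)
  qed
  have inner: "I (k + n) (sem n (PFor 23 (PSeq bid_pick bid)) t)" if "I k t" for k t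
  proof (rule sem_PFor_rule[where P = "\<lambda>j. I (k + j)" and Q = "I (k + n)"], goal_cases)
    case (2 j t)
    show ?case unfolding add_Suc_right by (rule step, rule I_put[OF 2(2)]) simp
  next
    case (3 t)
    show ?case by (rule I_put[OF 3]) simp
  qed (use that in simp)
  have "I (n * n) (sem n (PFor 22 (PFor 23 (PSeq bid_pick bid))) s2)"
  proof (rule sem_PFor_rule[where P = "\<lambda>i. I (i * n)" and Q = "I (n * n)"], goal_cases)
    case 1
    have "graph_memory n E s2" by (rule graph_memory_cong[OF gm]) (simp_all add: f1 f2)
    moreover have "auction_inv n E L R (s2 16) (s2 17)"
      unfolding auction_inv_def using LR s1 s2 f2[of 16] by auto
    ultimately show ?case unfolding I_def by (simp add: f1 f2)
  next
    case (2 i t)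
    have "I (i * n + n) (sem n (PFor 23 (PSeq bid_pick bid)) (put 22 i t))"
      by (rule inner, rule I_put[OF 2(2)]) simp
    then show ?case by (simp only: mult_Suc add.commute)
  next
    case (3 t)
    show ?case by (rule I_put[OF 3]) simp
  qed
  then have I: "I (n * n) t"
    by (simp only: t auction_def sem.simps(2) s1_def s2_def)
  then show inv: "auction_inv n E L R (t 16) (t 17)" unfolding I_def by blast
  show "auction_done n E L R (t 16) (t 17)"
  proof (rule ccontr)
    assume "\<not> ?thesis"
    then have large: "n * n \<le> sum (t 17) {..<n}"
        and "\<exists>r\<in>R. t 17 r < n"
      using I unfolding I_def auction_done_def by force+
    then obtain r where r: "r \<in> R" "t 17 r < n" by blast
    \<comment> \<open>An unfinished auction has an item priced below \<open>n\<close>, and no price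
      exceeds \<open>n\<close>, so the sum is too small for \<open>n * n\<close> bids.\<close>
    have "sum (t 17) {..<n} < (\<Sum>_<n. n)"
      by (rule sum_strict_mono_ex1) (use r LR auction_inv_le[OF inv] in auto)
    then show False using large by simp
  qed
qed

section \<open>Testing candidates\<close>

definition independent_memory :: "nat \<Rightarrow> nat set set \<Rightarrow> memory \<Rightarrow> bool" where
  "independent_memory n E s \<longleftrightarrow>
     independent_set {..<n} E (members n s 2) \<and> s 19 0 = card (members n s 2)"

lemma independent_memory_cong:
  "independent_memory n E s \<Longrightarrow> s' 2 = s 2 \<Longrightarrow> s' 19 = s 19 \<Longrightarrow> independent_memory n E s'"
  by (simp add: independent_memory_def members_def)

lemma written_try_candidate: "written try_candidate = {2, 12, 13, 18, 19, 20, 21}"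
  by (auto simp: try_candidate_def candidate_def check_independent_def accept_independent_def)

text \<open>Array 2 changes only to a strictly larger set that was checked to be independent, so
  wrong guesses and thresholds do no damage.\<close>

lemma sem_try_candidate:
  assumes gm: "graph_memory n E s" and im: "independent_memory n E s"
    and t: "t = sem n try_candidate s"
    and C: "C = members n s 14 \<union> threshold_set (bidders n s) (items n s) (s 16) (s 17) (Suc (s 24 0))"
  shows "independent_memory n E t" and "s 19 0 \<le> t 19 0"
    and "independent_set {..<n} E C \<Longrightarrow> card C \<le> t 19 0"
proof -
  define s0 where "s0 = sem n (cmap 20 true_exp 18 (At 14 (Var 20))) s"
  define s1 where "s1 = sem n candidate s"
  define s2 where "s2 = sem n check_independent s1"
  define s3 where "s3 = sem n (count_if 20 (nonzero (At 18 (Var 20))) 13) s2"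
  have t_eq: "t = sem n accept_independent s3"
    unfolding t s3_def s2_def s1_def try_candidate_def by simp
  have f0: "s0 b = s b" if "b \<notin> {20, 18}" for b
    unfolding s0_def by (rule sem_frame) (use that in simp)
  have f1: "s1 b = s b" if "b \<notin> {20, 18}" for b
    unfolding s1_def by (rule sem_frame) (use that in \<open>simp add: candidate_def\<close>)
  have f2: "s2 b = s1 b" if "b \<notin> {12, 20, 21}" for b
    unfolding s2_def by (rule sem_frame) (use that in \<open>simp add: check_independent_def\<close>)
  have f3: "s3 b = s2 b" if "b \<notin> {13, 20}" for b
    unfolding s3_def by (rule sem_frame) (use that in simp)
  have gm1: "graph_memory n E s1" by (rule graph_memory_cong[OF gm]) (simp_all add: f1)
  have s0: "s0 18 v = (if v < n \<and> True then s 14 v else s 18 v)" for v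
    unfolding s0_def by (rule sem_cmap) simp_all
  define T where "T = threshold_set (bidders n s) (items n s) (s 16) (s 17) (Suc (s 24 0))"
  have s1: "s1 18 v = (if v < n \<and> v \<in> T then 1 else s0 18 v)" for v
    unfolding s1_def candidate_def sem.simps s0_def[symmetric]
  proof (rule sem_cmap, goal_cases)
    case (2 s')
    have "s' 15 = s 15" "s' 5 = s 5" "s' 16 = s 16" "s' 17 = s 17" "s' 24 = s 24"
      using 2 f0 by simp_all
    then show ?case using 2(2)
      unfolding T_def threshold_set_def bidders_def items_def members_def
      by (simp add: is_one_iff) blast
  qed simp
  have T: "T \<subseteq> {..<n}"
    unfolding T_def threshold_set_def bidders_def items_def members_def by auto
  have C1: "v \<in> C \<longleftrightarrow> v < n \<and> s1 18 v \<noteq> 0" for v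
    unfolding C T_def[symmetric] members_def using T by (auto simp: s1 s0)
  have flag: "s2 12 0 = (if \<exists>u<n. \<exists>v<n. u \<in> C \<and> v \<in> C \<and> {u, v} \<in> E then 1 else 0)"
    unfolding s2_def check_independent_def
  proof (rule sem_any2, goal_cases)
    case (4 s')
    let ?u = "s' 20 0" and ?v = "s' 21 0"
    have "s' 1 (s' 3 ?u + ?v) = (if {?u, ?v} \<in> E then 1 else 0)"
      using gm1 4 unfolding graph_memory_def by simp
    moreover have "s' 18 = s1 18" using 4 by simp
    ultimately show ?case using 4(2,3) by (simp add: C1)
  qed simp_all
  have ind: "s2 12 0 = 0 \<longleftrightarrow> independent_set {..<n} E C"
  proof -
    have "C \<subseteq> {..<n}" using C1 by auto
    then show ?thesis unfolding flag independent_set_def by (simp; blast)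
  qed
  have "s3 13 0 = card {v. v < n \<and> s2 18 v \<noteq> 0}"
    unfolding s3_def by (rule sem_count_if) simp_all
  also have "{v. v < n \<and> s2 18 v \<noteq> 0} = C" using C1 f2[of 18] by auto
  finally have cnt: "s3 13 0 = card C" .
  have s3s: "s3 2 = s 2" "s3 19 = s 19" "s3 12 = s2 12" "s3 18 = s1 18"
    by (simp_all add: f3 f2 f1)
  have "independent_memory n E t \<and> s 19 0 \<le> t 19 0 \<and>
    (independent_set {..<n} E C \<longrightarrow> card C \<le> t 19 0)"
  proof (cases "s2 12 0 = 0 \<and> s 19 0 < card C")
    case False
    then have "t = s3" unfolding t_eq accept_independent_def by (auto simp: cnt s3s)
    then show ?thesis
      using False independent_memory_cong[OF im, of t] s3s ind by auto
  next
    case True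
    define s4 where "s4 = sem n (cmap 20 true_exp 2 (At 18 (Var 20))) s3"
    have t4: "t = put 19 (s4 13 0) s4"
      using True unfolding t_eq accept_independent_def s4_def by (simp add: cnt s3s)
    have f4: "s4 b = s3 b" if "b \<notin> {2, 20}" for b
      unfolding s4_def by (rule sem_frame) (use that in simp)
    have "s4 2 v = (if v < n \<and> True then s3 18 v else s3 2 v)" for v
      unfolding s4_def by (rule sem_cmap) simp_all
    then have "members n t 2 = C" unfolding members_def t4 using C1 s3s by auto
    moreover have "t 19 0 = card C" using t4 f4[of 13] cnt by simp
    ultimately show ?thesis using True ind unfolding independent_memory_def by simp
  qed
  then show "independent_memory n E t" and "s 19 0 \<le> t 19 0"
    and "independent_set {..<n} E C \<Longrightarrow> card C \<le> t 19 0" by auto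
qed

lemma written_search: "written (search k) \<subseteq> {2, 9, 10, 11, 12, 13, 14, 15, 16, 17, 18, 19, 20, 21, 22, 23, 24}"
  by (auto simp: search_def guess_tuple_def remove_neighbours_def auction_def bid_pick_def bid_def
      written_try_candidate written_store_tuple)

lemma wf_prog_search: "wf_prog (search k)"
  by (simp add: search_def guess_tuple_def remove_neighbours_def auction_def bid_pick_def bid_def
      wf_prog_store_tuple written_try_candidate)
    (simp add: try_candidate_def candidate_def check_independent_def accept_independent_def)

text \<open>A good guess lies in \<open>S\<close> and contains every vertex of \<open>S\<close>
  outside the current bipartite set. The other vertices of \<open>S\<close> survive the removal of
  the neighbours of the guess, so they are at most as many as those of the best threshold set, and
  this set stays independent when the guess is added.\<close>

lemma sem_search:
  assumes gm: "graph_memory n E s" and cb: "colored_bipartite n E s" and im: "independent_memory n E s"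
    and n: "0 < n" and t: "t = sem n (search k) s"
  shows "independent_memory n E t" and "s 19 0 \<le> t 19 0"
    and "independent_set {..<n} E S \<Longrightarrow>
      S - members n s 4 \<subseteq> (\<lambda>j. s (30 + j) 0) ` {..<Suc k} \<Longrightarrow>
      (\<lambda>j. s (30 + j) 0) ` {..<Suc k} \<subseteq> S \<Longrightarrow> card S \<le> t 19 0"
proof -
  define s1 where "s1 = sem n (guess_tuple k) s"
  define s2 where "s2 = sem n remove_neighbours s1"
  define s3 where "s3 = sem n auction s2"
  define X where "X = members n s1 14"
  define A where "A = members n s 4"
  define H where "H = members n s2 15"
  have t_eq: "t = sem n (PFor 24 try_candidate) s3"
    unfolding t s3_def s2_def s1_def search_def by simp
  have f1: "s1 b = s b" if "b \<notin> {14, 20}" for b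
    unfolding s1_def
    by (rule sem_frame) (use that in \<open>simp add: guess_tuple_def written_store_tuple\<close>)
  have f2: "s2 b = s1 b" if "b \<notin> {15, 20, 21}" for b
    unfolding s2_def by (rule sem_frame) (use that in \<open>simp add: remove_neighbours_def\<close>)
  have f3: "s3 b = s2 b" if "b \<notin> {9, 10, 11, 16, 17, 20, 21, 22, 23}" for b
    unfolding s3_def
    by (rule sem_frame) (use that in \<open>simp add: auction_def bid_pick_def bid_def\<close>)
  have gm1: "graph_memory n E s1" by (rule graph_memory_cong[OF gm]) (simp_all add: f1)
  have gm2: "graph_memory n E s2" by (rule graph_memory_cong[OF gm1]) (simp_all add: f2)
  have gm3: "graph_memory n E s3" by (rule graph_memory_cong[OF gm2]) (simp_all add: f3)
  have im3: "independent_memory n E s3"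
    by (rule independent_memory_cong[OF im]) (simp_all add: f3 f2 f1)
  have X: "X = (\<lambda>j. s (30 + j) 0) ` {..<Suc k} \<inter> {..<n}"
    unfolding X_def s1_def by (rule sem_guess_tuple)
  have "members n s1 4 = A" unfolding A_def members_def by (simp add: f1)
  then have H: "H = {v \<in> A. \<forall>u\<in>X. {u, v} \<notin> E}"
    unfolding H_def s2_def X_def using sem_remove_neighbours[OF gm1] by simp
  define L R where "L = bidders n s2" and "R = items n s2"
  have LR_H: "L \<union> R = H" "L \<inter> R = {}"
    unfolding L_def R_def bidders_def items_def H_def by auto
  have "H \<subseteq> {..<n}" unfolding H_def members_def by auto
  then have LRn: "L \<subseteq> {..<n}" "R \<subseteq> {..<n}" using LR_H by auto
  define g where "g = threshold_set L R (s3 16) (s3 17)"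
  have bip: "(u \<in> L) \<noteq> (v \<in> L)" if "u \<in> L \<union> R" "v \<in> L \<union> R" "{u, v} \<in> E" for u v
  proof -
    have uv: "u \<in> H" "v \<in> H" using that LR_H by auto
    then have "u \<in> A" "v \<in> A" unfolding H by auto
    then have "(s 5 u = 1) \<noteq> (s 5 v = 1)"
      using cb that unfolding colored_bipartite_def A_def by blast
    moreover have "s2 5 = s 5" by (simp add: f2 f1)
    ultimately show ?thesis using uv unfolding L_def bidders_def H_def by simp
  qed
  have "\<exists>k<n. independent_set {..<n} E (g (Suc k)) \<and>
      (\<forall>T\<subseteq>L \<union> R. independent_set {..<n} E T \<longrightarrow> card T \<le> card (g (Suc k)))"
    unfolding g_def
    by (rule auction_optimal[OF sem_auction[OF gm2 L_def R_def s3_def] LRn LR_H(2) n bip])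
  then obtain k0 where k0: "k0 < n" "independent_set {..<n} E (g (Suc k0))"
      and k0_max: "\<And>T. T \<subseteq> H \<Longrightarrow> independent_set {..<n} E T \<Longrightarrow> card T \<le> card (g (Suc k0))"
    unfolding LR_H(1) by blast
  let ?Q = "\<lambda>t. independent_memory n E t \<and> s 19 0 \<le> t 19 0 \<and>
    (independent_set {..<n} E (X \<union> g (Suc k0)) \<longrightarrow> card (X \<union> g (Suc k0)) \<le> t 19 0)"
  have "?Q t" unfolding t_eq
  proof (rule sem_PFor_rule[where Q = ?Q and P = "\<lambda>j t. graph_memory n E t \<and>
      t 14 = s3 14 \<and> t 15 = s3 15 \<and> t 5 = s3 5 \<and> t 16 = s3 16 \<and> t 17 = s3 17 \<and>
      independent_memory n E t \<and> s 19 0 \<le> t 19 0 \<and>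
      (k0 < j \<longrightarrow> independent_set {..<n} E (X \<union> g (Suc k0)) \<longrightarrow> card (X \<union> g (Suc k0)) \<le> t 19 0)"], goal_cases)
    case 1
    show ?case using gm3 im3 by (simp add: f3 f2 f1)
  next
    case (2 j t)
    let ?s = "put 24 j t" and ?t = "sem n try_candidate (put 24 j t)"
    have s: "?s 14 = s3 14" "?s 15 = s3 15" "?s 5 = s3 5" "?s 16 = s3 16" "?s 17 = s3 17"
        "?s 24 0 = j" "?s 19 0 = t 19 0"
      using 2 by simp_all
    have gms: "graph_memory n E ?s" using 2 graph_memory_cong[of n E t ?s] by simp
    have ims: "independent_memory n E ?s" using 2 independent_memory_cong[of n E t ?s] by simp
    have "bidders n ?s = L" "items n ?s = R" "members n ?s 14 = X"
      unfolding L_def R_def X_def bidders_def items_def members_def s by (simp_all add: f3 f2)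
    then have C: "X \<union> g (Suc j) = members n ?s 14 \<union>
        threshold_set (bidders n ?s) (items n ?s) (?s 16) (?s 17) (Suc (?s 24 0))"
      unfolding g_def s by simp
    note tc = sem_try_candidate[OF gms ims refl C]
    have fr: "?t b = ?s b" if "b \<in> {14, 15, 5, 16, 17}" for b
      by (rule sem_frame) (use that in \<open>auto simp: written_try_candidate\<close>)
    have "graph_memory n E ?t"
      by (rule graph_memory_sem[OF gms]) (simp add: written_try_candidate)
    moreover have "?t 14 = s3 14" "?t 15 = s3 15" "?t 5 = s3 5" "?t 16 = s3 16" "?t 17 = s3 17"
      using fr 2 by simp_all
    moreover have "k0 < Suc j \<longrightarrow> independent_set {..<n} E (X \<union> g (Suc k0)) \<longrightarrow>
        card (X \<union> g (Suc k0)) \<le> ?t 19 0"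
    proof (intro impI)
      assume j: "k0 < Suc j" and ind: "independent_set {..<n} E (X \<union> g (Suc k0))"
      show "card (X \<union> g (Suc k0)) \<le> ?t 19 0"
      proof (cases "k0 = j")
        case True
        then show ?thesis using tc(3) ind by simp
      next
        case False
        then have "card (X \<union> g (Suc k0)) \<le> t 19 0" using j ind 2 by simp
        then show ?thesis using tc(2) s(7) by simp
      qed
    qed
    moreover have "s 19 0 \<le> ?t 19 0" using tc(2) s(7) 2 by simp
    ultimately show ?case using tc(1) by blast
  next
    case (3 t)
    then show ?case using k0(1) independent_memory_cong[of n E t "put 24 n t"] by simp
  qed
  then show "independent_memory n E t" and "s 19 0 \<le> t 19 0" by blast+
  show "card S \<le> t 19 0" if S: "independent_set {..<n} E S"
      "S - members n s 4 \<subseteq> (\<lambda>j. s (30 + j) 0) ` {..<Suc k}"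
      "(\<lambda>j. s (30 + j) 0) ` {..<Suc k} \<subseteq> S"
  proof -
    have Sn: "S \<subseteq> {..<n}" and SE: "\<And>u v. u \<in> S \<Longrightarrow> v \<in> S \<Longrightarrow> {u, v} \<notin> E"
      using S(1) unfolding independent_set_def by auto
    have XS: "X \<subseteq> S" "S - A \<subseteq> X" using S Sn unfolding X A_def by auto
    have gH: "g (Suc k0) \<subseteq> H" using LR_H(1) unfolding g_def threshold_set_def by auto
    have SH: "S \<inter> A \<subseteq> H" unfolding H using SE XS by auto
    have "independent_set {..<n} E (S \<inter> A)" using S(1) unfolding independent_set_def by auto
    then have le: "card (S \<inter> A) \<le> card (g (Suc k0))" using k0_max SH by simp
    have HX: "{u, v} \<notin> E \<and> {v, u} \<notin> E" if "u \<in> X" "v \<in> g (Suc k0)" for u v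
      using that gH unfolding H by (auto simp: insert_commute)
    have "independent_set {..<n} E (X \<union> g (Suc k0))"
      unfolding independent_set_def
    proof (intro conjI ballI)
      show "X \<union> g (Suc k0) \<subseteq> {..<n}" using XS Sn gH \<open>H \<subseteq> {..<n}\<close> by auto
      fix u v assume "u \<in> X \<union> g (Suc k0)" "v \<in> X \<union> g (Suc k0)"
      then show "{u, v} \<notin> E"
        using HX[of u v] HX[of v u] SE[of u v] XS k0(2) unfolding independent_set_def by blast
    qed
    then have c: "card (X \<union> g (Suc k0)) \<le> t 19 0" using \<open>?Q t\<close> by blast
    have fin: "finite S" "finite (g (Suc k0))" "finite X"
      using Sn XS gH \<open>H \<subseteq> {..<n}\<close> by (meson finite_lessThan finite_subset)+
    \<comment> \<open>The guess \<open>X\<close> may overlap the threshold set, so the count uses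
      \<open>S - A\<close>, which is disjoint from it because \<open>g (Suc k0)\<close> lies in
      \<open>A\<close>.\<close>
    have "card S = card (S - A) + card (S \<inter> A)"
      using fin by (metis add.commute card_Int_Diff)
    also have "\<dots> \<le> card (S - A) + card (g (Suc k0))" using le by simp
    also have "\<dots> = card ((S - A) \<union> g (Suc k0))"
      by (rule card_Un_disjoint[symmetric]) (use fin gH H in auto)
    also have "\<dots> \<le> card (X \<union> g (Suc k0))"
      by (rule card_mono) (use fin XS in auto)
    finally show "card S \<le> t 19 0" using c by simp
  qed
qed

section \<open>Sweeps and rounds of the local search\<close>

lemma locally_maximumD:
  assumes "locally_maximum n E k S" "S \<subseteq> {..<n}" "bipartite_on E (toggle n S (f ` {..<k}))"
  shows "card (toggle n S (f ` {..<k})) \<le> card S"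
proof (cases "f ` {..<k} \<inter> {..<n} = {}")
  case True
  then have "toggle n S (f ` {..<k}) = S"
    using assms(2) unfolding toggle_def by auto
  then show ?thesis by simp
next
  case False
  have "card (f ` {..<k} \<inter> {..<n}) \<le> card (f ` {..<k})" by (rule card_mono) auto
  also have "\<dots> \<le> k" using card_image_le[of "{..<k}" f] by simp
  finally obtain g where g: "g ` {..<k} = f ` {..<k} \<inter> {..<n}"
    using tuple_of_set[of "f ` {..<k} \<inter> {..<n}"] False by blast
  have eq: "toggle n S (g ` {..<k}) = toggle n S (f ` {..<k})"
    unfolding g toggle_def by auto
  have "\<forall>j<k. g j < n" using g by blast
  then show ?thesis
    using assms(1,3) unfolding locally_maximum_def eq[symmetric] by simp
qed

text \<open>A set that is unchanged after trying every tuple admits no profitable exchange. The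
  third claim makes local maximality, once reached, persist through the later rounds.\<close>

lemma sem_improve_sweep:
  assumes gm: "graph_memory n E s" and cb: "colored_bipartite n E s"
    and t: "t = sem n (nest (Suc k) (improve k)) s"
  shows "graph_memory n E t" and "colored_bipartite n E t"
    and "locally_maximum n E (Suc k) (members n s 4) \<Longrightarrow> members n t 4 = members n s 4"
    and "card (members n s 4) < card (members n t 4) \<or> locally_maximum n E (Suc k) (members n t 4)"
proof -
  define A where "A = members n s 4"
  define I where "I = (\<lambda>t. graph_memory n E t \<and> colored_bipartite n E t \<and>
    (members n t 4 = A \<or> card A < card (members n t 4)))"
  have put_cong: "graph_memory n E (put (30 + j) x t) = graph_memory n E t"
      "colored_bipartite n E (put (30 + j) x t) = colored_bipartite n E t"
      "members n (put (30 + j) x t) 4 = members n t 4" for j x t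
    by (simp_all add: graph_memory_def colored_bipartite_def members_def)
  have step: "graph_memory n E (sem n (improve k) t)" if "graph_memory n E t" for t
    by (rule graph_memory_sem[OF that]) (use written_improve[of k] in auto)
  have I_step: "I (sem n (improve k) t)" if "I t" for t
  proof -
    have It: "graph_memory n E t" "colored_bipartite n E t"
        "members n t 4 = A \<or> card A < card (members n t 4)"
      using that unfolding I_def by blast+
    note si = sem_improve(1,2)[OF It(1,2) refl refl, of k]
    have "members n (sem n (improve k) t) 4 = A \<or> card A < card (members n (sem n (improve k) t) 4)"
      using si(2) It(3) by (elim disjE conjE) simp_all
    then show ?thesis using step[OF It(1)] si(1) unfolding I_def by blast
  qed
  have I_t: "I t" unfolding t
    by (rule sem_nest_inv[where I = I]) (use gm cb I_step in \<open>auto simp: I_def put_cong A_def\<close>)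
  then show "graph_memory n E t" and "colored_bipartite n E t" unfolding I_def by blast+
  show "members n t 4 = members n s 4" if lm: "locally_maximum n E (Suc k) (members n s 4)"
  proof -
    let ?I = "\<lambda>t. graph_memory n E t \<and> colored_bipartite n E t \<and> members n t 4 = A"
    have An: "A \<subseteq> {..<n}" unfolding A_def members_def by auto
    have "?I (sem n (improve k) t)" if "?I t" for t
    proof -
      have It: "graph_memory n E t" "colored_bipartite n E t" "members n t 4 = A"
        using that by blast+
      let ?A' = "toggle n A ((\<lambda>j. t (30 + j) 0) ` {..<Suc k})"
      note si = sem_improve[OF It(1,2) refl refl, of k, unfolded It(3)]
      have "\<not> card A < card ?A'" if "bipartite_on E ?A'"
        using locally_maximumD[OF lm[folded A_def] An that] by simp
      note not_larger = this
      have "members n (sem n (improve k) t) 4 = A"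
        using si(2)
      proof (elim disjE conjE)
        assume A': "members n (sem n (improve k) t) 4 = ?A'" and "card A < card ?A'"
        have "bipartite_on E ?A'" using bipartite_on_colored[OF si(1)] unfolding A' .
        then show ?thesis using not_larger \<open>card A < card ?A'\<close> by blast
      qed
      then show ?thesis using si(1) step[OF It(1)] by blast
    qed
    note I_step = this
    have "?I t" unfolding t
      by (rule sem_nest_inv[where I = ?I]) (use gm cb I_step in \<open>auto simp: put_cong A_def\<close>)
    then show ?thesis unfolding A_def by blast
  qed
  show "card (members n s 4) < card (members n t 4) \<or> locally_maximum n E (Suc k) (members n t 4)"
  proof (cases "members n t 4 = A")
    case False
    then show ?thesis using I_t unfolding I_def A_def by blast
  next
    case True
    have "card (toggle n A (f ` {..<Suc k})) \<le> card A"
      if f: "\<forall>j<Suc k. f j < n" and bip: "bipartite_on E (toggle n A (f ` {..<Suc k}))" for f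
    proof -
      let ?c = "card (toggle n A (f ` {..<Suc k}))"
      \<comment> \<open>The second disjunct covers the case that an earlier tuple has already
        enlarged the set when \<open>f\<close> comes up; at the end it is excluded, since the final
        set is \<open>A\<close>.\<close>
      let ?Q = "\<lambda>t. ?c \<le> card (members n t 4) \<or> card A < card (members n t 4)"
      have mono: "card (members n t 4) \<le> card (members n (sem n (improve k) t) 4)" if "I t" for t
        using that sem_improve(2)[of n E t _ k, OF _ _ refl refl] unfolding I_def by auto
      have "?Q t" unfolding t
      proof (rule sem_nest_hit[where I = I and Q = ?Q and f = f], goal_cases)
        case (3 t)
        then show ?case by (rule I_step)
      next
        case (4 t)
        then show ?case using mono[of t] by linarith
      next
        case (5 t)
        show ?case
        proof (cases "members n t 4 = A")
          case True
          have "(\<lambda>j. t (30 + j) 0) ` {..<Suc k} = f ` {..<Suc k}"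
            by (rule image_cong) (use 5(2) in auto)
          then show ?thesis
            using sem_improve(3)[of n E t _ k, OF _ _ refl refl] 5(1) bip True
            unfolding I_def by auto
        next
          case False
          then show ?thesis using 5(1) mono[of t] unfolding I_def by auto
        qed
      next
        case 6
        show ?case using written_improve[of k] by auto
      next
        case 8
        show ?case using gm cb unfolding I_def A_def by blast
      qed (use f in \<open>auto simp: I_def put_cong\<close>)
      then show ?thesis using True by auto
    qed
    then show ?thesis unfolding locally_maximum_def True by blast
  qed
qed

text \<open>A round that does not end in a local maximum adds at least one vertex. After
  \<open>n\<close> such rounds the set has \<open>n\<close> vertices, and no exchange can enlarge
  it.\<close>

lemma sem_improve_rounds:
  assumes gm: "graph_memory n E s" and cb: "colored_bipartite n E s"
    and t: "t = sem n (PFor 25 (nest (Suc k) (improve k))) s"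
  shows "graph_memory n E t" and "colored_bipartite n E t"
    and "locally_maximum n E (Suc k) (members n t 4)"
proof -
  let ?I = "\<lambda>r t. graph_memory n E t \<and> colored_bipartite n E t \<and>
    (r \<le> card (members n t 4) \<or> locally_maximum n E (Suc k) (members n t 4))"
  have put_cong: "graph_memory n E (put 25 x t) = graph_memory n E t"
      "colored_bipartite n E (put 25 x t) = colored_bipartite n E t"
      "members n (put 25 x t) 4 = members n t 4" for x t
    by (simp_all add: graph_memory_def colored_bipartite_def members_def)
  have I: "?I n t" unfolding t
  proof (rule sem_PFor_rule[where P = ?I and Q = "?I n"], goal_cases)
    case (2 r t)
    then have "graph_memory n E (put 25 r t)" "colored_bipartite n E (put 25 r t)"
      unfolding put_cong by blast+
    note sweep = sem_improve_sweep[OF this refl, of k, unfolded put_cong]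
    show ?case
    proof (cases "locally_maximum n E (Suc k) (members n t 4)")
      case True
      then show ?thesis using sweep(1,2) sweep(3)[OF True] by simp
    next
      case False
      then show ?thesis using sweep(1,2,4) 2(2) by auto
    qed
  qed (use gm cb in \<open>simp_all add: put_cong\<close>)
  then show "graph_memory n E t" and "colored_bipartite n E t" by blast+
  show "locally_maximum n E (Suc k) (members n t 4)"
  proof (rule ccontr)
    assume not_max: "\<not> ?thesis"
    then have "n \<le> card (members n t 4)" using I by blast
    moreover have "card (toggle n S T) \<le> n" for S T
      using card_mono[of "{..<n}" "toggle n S T"] unfolding toggle_def by auto
    ultimately have "card (toggle n S T) \<le> card (members n t 4)" for S T
      using order_trans by blast
    then show False using not_max unfolding locally_maximum_def by blast
  qed
qed

section \<open>All guesses, and the whole program\<close>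

lemma sem_search_all:
  assumes gm: "graph_memory n E s" and cb: "colored_bipartite n E s" and im: "independent_memory n E s"
    and n: "0 < n" and t: "t = sem n (nest (Suc k) (search k)) s"
  shows "independent_memory n E t"
    and "independent_set {..<n} E S \<Longrightarrow> card (S - members n s 4) \<le> Suc k \<Longrightarrow> card S \<le> t 19 0"
proof -
  define A where "A = members n s 4"
  define I where "I = (\<lambda>t. graph_memory n E t \<and> colored_bipartite n E t \<and>
    independent_memory n E t \<and> members n t 4 = A)"
  have I_put: "I (put (30 + j) x t) = I t" for j x t
    by (simp add: I_def graph_memory_def colored_bipartite_def independent_memory_def members_def)
  have I_step: "I (sem n (search k) t)" if "I t" for t
  proof -
    have It: "graph_memory n E t" "colored_bipartite n E t" "independent_memory n E t"
        "members n t 4 = A"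
      using that unfolding I_def by blast+
    have fr: "sem n (search k) t b = t b" if "b \<in> {4, 5, 6}" for b
      by (rule sem_frame) (use written_search[of k] that in auto)
    have "graph_memory n E (sem n (search k) t)"
      by (rule graph_memory_sem[OF It(1)]) (use written_search[of k] in auto)
    moreover have "colored_bipartite n E (sem n (search k) t)"
      by (rule colored_bipartite_cong[OF It(2)]) (simp_all add: fr)
    moreover have "members n (sem n (search k) t) 4 = A"
      using It(4) fr[of 4] unfolding members_def by simp
    ultimately show ?thesis using sem_search(1)[OF It(1-3) n refl] unfolding I_def by blast
  qed
  have I_s: "I s" unfolding I_def A_def using gm cb im by blast
  have "I t" unfolding t
    by (rule sem_nest_inv[where I = I]) (use I_put I_step I_s in simp_all)
  then show "independent_memory n E t" unfolding I_def by blast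
  show "card S \<le> t 19 0"
    if S: "independent_set {..<n} E S" and small: "card (S - members n s 4) \<le> Suc k"
  proof (cases "S = {}")
    case True
    then show ?thesis by simp
  next
    case False
    then obtain x where x: "x \<in> S" by blast
    have Sn: "S \<subseteq> {..<n}" using S unfolding independent_set_def by blast
    then have finS: "finite S" by (rule finite_subset) simp
    \<comment> \<open>A tuple of length \<open>Suc k\<close> is never empty; if \<open>S\<close>
      lies inside \<open>A\<close>, any vertex of \<open>S\<close> serves as the guess.\<close>
    define X where "X = (if S - A = {} then {x} else S - A)"
    have "finite X" "X \<noteq> {}" "card X \<le> Suc k"
      using finS small unfolding X_def A_def by auto
    then obtain f where f: "f ` {..<Suc k} = X" by (rule tuple_of_set)
    have X: "X \<subseteq> S" "S - A \<subseteq> X" using x unfolding X_def by auto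
    have fn: "f j < n" if "j < Suc k" for j
    proof -
      have "f j \<in> X" using f that by blast
      then show ?thesis using X Sn by blast
    qed
    let ?Q = "\<lambda>t. card S \<le> t 19 0"
    show ?thesis unfolding t
    proof (rule sem_nest_hit[where I = I and Q = ?Q and f = f], goal_cases)
      case (3 t)
      then show ?case by (rule I_step)
    next
      case (4 t)
      then have "t 19 0 \<le> sem n (search k) t 19 0"
        using sem_search(2)[of n E t _ k, OF _ _ _ n refl] unfolding I_def by blast
      then show ?case using 4(2) by simp
    next
      case (5 t)
      have "(\<lambda>j. t (30 + j) 0) ` {..<Suc k} = f ` {..<Suc k}"
        by (rule image_cong) (use 5(2) in auto)
      then show ?case
        using sem_search(3)[of n E t _ k S, OF _ _ _ n refl S] 5(1) X f unfolding I_def by simp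
    next
      case 6
      show ?case using written_search[of k] by fastforce
    next
      case 8
      show ?case by (rule I_s)
    qed (use fn in \<open>simp_all add: I_put\<close>)
  qed
qed

lemma sem_rows:
  assumes "t = sem n rows (input_memory n E)"
  shows "graph_memory n E t"
proof -
  let ?s = "input_memory n E"
  let ?Q = "\<lambda>t. t 0 = ?s 0 \<and> t 1 = ?s 1 \<and> (\<forall>u<n. t 3 u = u * n)"
  have Q: "?Q t" unfolding assms rows_def
  proof (rule sem_PFor_rule[where Q = ?Q and P = "\<lambda>j t. t 0 = ?s 0 \<and> t 1 = ?s 1 \<and>
      (\<forall>u<j. t 3 u = u * n) \<and> t 26 0 = j * n"], goal_cases)
    case 1
    show ?case by (simp add: input_memory_def)
  next
    case (2 j t)
    then show ?case by (auto simp: less_Suc_eq input_memory_def)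
  qed simp
  have "?s 1 (u * n + v) = (if {u, v} \<in> E then 1 else 0)" if "u < n" "v < n" for u v
  proof -
    have "u * n + v < Suc u * n" using that by simp
    also have "\<dots> \<le> n * n" using that by (intro mult_le_mono1) simp
    finally show ?thesis using that by (simp add: input_memory_def)
  qed
  then show ?thesis using Q unfolding graph_memory_def by (simp add: input_memory_def)
qed

lemma max_independent_prog_correct:
  assumes kl: "kl_graph 2 l {..<n} E"
  shows "max_independent_set {..<n} E
    (output_set n (sem n (max_independent_prog l) (input_memory n E)))"
proof -
  let ?k = "4 * l"
  define s1 where "s1 = sem n rows (input_memory n E)"
  define s2 where "s2 = sem n (PFor 25 (nest (Suc ?k) (improve ?k))) s1"
  define t where "t = sem n (nest (Suc ?k) (search ?k)) s2"
  have t: "sem n (max_independent_prog l) (input_memory n E) = t"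
    unfolding t_def s2_def s1_def max_independent_prog_def by (simp only: sem.simps(2) Suc_eq_plus1)
  have out: "output_set n t = members n t 2" unfolding output_set_def members_def by simp
  have f1: "s1 b = input_memory n E b" if "b \<notin> {3, 20, 26}" for b
    unfolding s1_def by (rule sem_frame) (use that in \<open>simp add: rows_def\<close>)
  have f2: "s2 b = s1 b" if "b \<in> {2, 19}" for b
    unfolding s2_def
    by (rule sem_frame) (use that written_improve[of ?k] in \<open>auto simp: written_nest\<close>)
  have gm1: "graph_memory n E s1" by (rule sem_rows[OF s1_def])
  have "colored_bipartite n E s1"
    unfolding colored_bipartite_def members_def by (simp add: f1 input_memory_def)
  note 2 = sem_improve_rounds[OF gm1 this s2_def]
  have im2: "independent_memory n E s2"
    unfolding independent_memory_def members_def independent_set_def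
    by (simp add: f1 f2 input_memory_def)
  show ?thesis
  \<comment> \<open>The auction needs a threshold between 1 and \<open>n\<close>; the empty graph
    has only the empty set as output.\<close>
  proof (cases "n = 0")
    case True
    then show ?thesis
      unfolding max_independent_set_def independent_set_def output_set_def by auto
  next
    case False
    then have n: "0 < n" by simp
    note search = sem_search_all[OF 2(1,2) im2 n t_def]
    obtain A B where AB: "kl_partition 2 l {..<n} E A B" using kl unfolding kl_graph_def by blast
    define Z D where "Z = (\<Union>i<2. A i)" and "D = (\<Union>j<l. B j)"
    have cl: "\<forall>j<l. clique {..<n} E (B j)" and ZD: "Z \<union> D = {..<n}"
      using AB unfolding kl_partition_def Z_def D_def by blast+
    have "members n s2 4 \<subseteq> {..<n}" unfolding members_def by auto
    from locally_maximum_almost_contains[OF AB this bipartite_on_colored[OF 2(2)]]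
    have close: "card (Z - members n s2 4) \<le> 2 * l" using 2(3) unfolding Z_def by simp
    have "card T \<le> card (members n t 2)" if T: "independent_set {..<n} E T" for T
    proof -
      have "card (T \<inter> D) \<le> l"
        unfolding D_def by (rule card_Int_cliques_le[OF T cl]) simp
      have Tn: "T \<subseteq> {..<n}" using T unfolding independent_set_def by blast
      have fin: "finite (T \<inter> D)" "finite (Z - members n s2 4)"
        using ZD Tn by (auto intro: finite_subset[of _ "{..<n}"])
      \<comment> \<open>Outside the bipartite set, \<open>T\<close> has at most \<open>l\<close>
        vertices in the cliques and at most \<open>2 * l\<close> in the sparse part, which fits into
        a tuple of length \<open>4 * l + 1\<close>.\<close>
      have "T - members n s2 4 \<subseteq> (T \<inter> D) \<union> (Z - members n s2 4)"
        using Tn ZD by blast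
      then have "card (T - members n s2 4) \<le> card ((T \<inter> D) \<union> (Z - members n s2 4))"
        using fin by (intro card_mono) auto
      also have "\<dots> \<le> card (T \<inter> D) + card (Z - members n s2 4)" by (rule card_Un_le)
      also have "\<dots> \<le> Suc ?k" using \<open>card (T \<inter> D) \<le> l\<close> close by simp
      finally have "card T \<le> t 19 0" by (rule search(2)[OF T])
      then show ?thesis using search(1) unfolding independent_memory_def by simp
    qed
    then show ?thesis
      using search(1) unfolding max_independent_set_def independent_memory_def t out by blast
  qed
qed

lemma wf_max_independent_prog: "wf_prog (max_independent_prog l)"
proof -
  have "wf_prog (nest k (improve j))" for j k
    by (rule wf_prog_nest[OF wf_prog_improve]) (use written_improve[of j] in fastforce)
  moreover have "wf_prog (nest k (search j))" for j k
    by (rule wf_prog_nest[OF wf_prog_search]) (use written_search[of j] in fastforce)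
  moreover have "25 \<notin> written (nest k (improve j))" for j k
    using written_improve[of j] by (auto simp: written_nest)
  ultimately show ?thesis by (simp add: max_independent_prog_def rows_def del: nest.simps)
qed

theorem corollary8:
  fixes l :: nat
  shows "poly_time_search (kl_graph 2 l) max_independent_set"
  by (rule poly_time_searchI[OF wf_max_independent_prog]) (rule max_independent_prog_correct)

end
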